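(* Let $p$ be a prime, let $G$ be a finite group and let $N$ be a normal subgroup of $G$. Suppose that every nonlinear irreducible $p$-Brauer character of $G$ has prime degree, i.e. $\varphi(1)$ is a prime number for every $\varphi\in\mathrm{IBr}(G)$ with $\varphi(1)>1$. Then either $N$ is an $M_p$-group or $G/N$ is an $M_p$-group.
   Context: For a fixed prime $p$, $\mathrm{IBr}(G)$ denotes the set of irreducible $p$-Brauer characters of the finite group $G$ (Brauer characters of irreducible representations of $G$ over an algebraically closed field of characteristic $p$). A Brauer character is linear if its degree is $1$ and nonlinear otherwise. A $p$-Brauer character of $G$ is monomial if it is induced from a linear $p$-Brauer character of some subgroup (not necessarily proper) of $G$. $G$ is an $M_p$-group if every $\varphi\in\mathrm{IBr}(G)$ is monomial. *)

theory Defs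
  imports
    "HOL-Algebra.Algebra"
    "HOL-Computational_Algebra.Computational_Algebra"
    "Jordan_Normal_Form.VS_Connect"
    "Jordan_Normal_Form.Char_Poly"
begin

hide_const (open) Divisibility.prime

definition p_roots_of_unity :: "nat \<Rightarrow> 'f::field set" where
  "p_roots_of_unity p = {x. \<exists>n>0. \<not> p dvd n \<and> x ^ n = 1}"

text \<open>
  The choice on which Brauer characters depend: an isomorphism from the group of roots of unity
  of order prime to \<open>p\<close> in an algebraically closed field of characteristic \<open>p\<close> onto the group of
  complex roots of unity of order prime to \<open>p\<close>. The values of \<open>\<theta>\<close> elsewhere are irrelevant.
\<close>

definition brauer_lift :: "nat \<Rightarrow> ('k::alg_closed_field \<Rightarrow> complex) \<Rightarrow> bool" where
  "brauer_lift p \<theta> \<longleftrightarrow>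
     bij_betw \<theta> (p_roots_of_unity p) (p_roots_of_unity p) \<and>
     (\<forall>x\<in>p_roots_of_unity p. \<forall>y\<in>p_roots_of_unity p. \<theta> (x * y) = \<theta> x * \<theta> y)"

definition p_regular :: "nat \<Rightarrow> ('a, 'b) monoid_scheme \<Rightarrow> 'a set" where
  "p_regular p G = {x \<in> carrier G. \<not> p dvd group.ord G x}"

definition representation ::
  "('a, 'b) monoid_scheme \<Rightarrow> nat \<Rightarrow> ('a \<Rightarrow> 'k::alg_closed_field mat) \<Rightarrow> bool" where
  "representation G n \<rho> \<longleftrightarrow> 0 < n \<and> \<rho> \<in> hom G (units_of (ring_mat TYPE('k) n ()))"

definition irreducible_representation ::
  "('a, 'b) monoid_scheme \<Rightarrow> nat \<Rightarrow> ('a \<Rightarrow> 'k::alg_closed_field mat) \<Rightarrow> bool" where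
  "irreducible_representation G n \<rho> \<longleftrightarrow>
     representation G n \<rho> \<and>
     (\<forall>W. subspace class_ring W (module_vec TYPE('k) n) \<and>
          (\<forall>g\<in>carrier G. \<forall>w\<in>W. \<rho> g *\<^sub>v w \<in> W) \<longrightarrow>
          W = {0\<^sub>v n} \<or> W = carrier_vec n)"

text \<open>
  Brauer characters live on the \<open>p\<close>-regular elements only; they are extensional functions
  (\<open>undefined\<close> elsewhere), so that equality of functions is equality of Brauer characters.
  The multiset \<open>proots (char_poly A)\<close> contains the eigenvalues of \<open>A\<close> with multiplicity.
\<close>

definition brauer_character ::
  "nat \<Rightarrow> ('k::alg_closed_field \<Rightarrow> complex) \<Rightarrow> ('a, 'b) monoid_scheme \<Rightarrow> ('a \<Rightarrow> 'k mat) \<Rightarrow> 'a \<Rightarrow> complex"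
  where
  "brauer_character p \<theta> G \<rho> =
     (\<lambda>g\<in>p_regular p G. \<Sum>e\<in>#proots (char_poly (\<rho> g)). \<theta> e)"

definition brauer_characters ::
  "nat \<Rightarrow> ('k::alg_closed_field \<Rightarrow> complex) \<Rightarrow> ('a, 'b) monoid_scheme \<Rightarrow> ('a \<Rightarrow> complex) set" where
  "brauer_characters p \<theta> G = {brauer_character p \<theta> G \<rho> | n \<rho>. representation G n \<rho>}"

definition IBr ::
  "nat \<Rightarrow> ('k::alg_closed_field \<Rightarrow> complex) \<Rightarrow> ('a, 'b) monoid_scheme \<Rightarrow> ('a \<Rightarrow> complex) set" where
  "IBr p \<theta> G = {brauer_character p \<theta> G \<rho> | n \<rho>. irreducible_representation G n \<rho>}"

definition linear_brauer_characters ::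
  "nat \<Rightarrow> ('k::alg_closed_field \<Rightarrow> complex) \<Rightarrow> ('a, 'b) monoid_scheme \<Rightarrow> ('a \<Rightarrow> complex) set" where
  "linear_brauer_characters p \<theta> G = {\<phi> \<in> brauer_characters p \<theta> G. \<phi> \<one>\<^bsub>G\<^esub> = 1}"

definition induced ::
  "nat \<Rightarrow> ('a, 'b) monoid_scheme \<Rightarrow> 'a set \<Rightarrow> ('a \<Rightarrow> complex) \<Rightarrow> 'a \<Rightarrow> complex" where
  "induced p G H \<phi> =
     (\<lambda>x\<in>p_regular p G.
        (\<Sum>y | y \<in> carrier G \<and> y \<otimes>\<^bsub>G\<^esub> x \<otimes>\<^bsub>G\<^esub> inv\<^bsub>G\<^esub> y \<in> H. \<phi> (y \<otimes>\<^bsub>G\<^esub> x \<otimes>\<^bsub>G\<^esub> inv\<^bsub>G\<^esub> y))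
        / of_nat (card H))"

definition monomial ::
  "nat \<Rightarrow> ('k::alg_closed_field \<Rightarrow> complex) \<Rightarrow> ('a, 'b) monoid_scheme \<Rightarrow> ('a \<Rightarrow> complex) \<Rightarrow> bool" where
  "monomial p \<theta> G \<phi> \<longleftrightarrow>
     (\<exists>H \<mu>. subgroup H G \<and> \<mu> \<in> linear_brauer_characters p \<theta> (G\<lparr>carrier := H\<rparr>) \<and>
            \<phi> = induced p G H \<mu>)"

definition M_p_group ::
  "nat \<Rightarrow> ('k::alg_closed_field \<Rightarrow> complex) \<Rightarrow> ('a, 'b) monoid_scheme \<Rightarrow> bool" where
  "M_p_group p \<theta> G \<longleftrightarrow> (\<forall>\<phi>\<in>IBr p \<theta> G. monomial p \<theta> G \<phi>)"

end

theory Submission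
  imports Defs
begin

text \<open>
  In fact all irreducible representations of \<open>N\<close>, or all those of \<open>G/N\<close>, are linear. Suppose \<open>\<sigma>\<close> is a nonlinear
  one of \<open>N\<close> and \<open>\<phi>\<close> a nonlinear one of \<open>G/N\<close>. A simple submodule \<open>\<chi>\<close> of the module induced from \<open>\<sigma>\<close>
  maps onto \<open>\<sigma>\<close> by evaluation at \<open>1\<close>, so as in Clifford's theorem \<open>\<sigma>(1)\<close> divides \<open>\<chi>(1)\<close>. As \<open>\<chi>(1)\<close>
  is prime, the degrees agree and \<open>\<chi>\<close> restricts irreducibly to \<open>N\<close>. Then, as in Gallagher's theorem, \<open>\<chi> \<otimes> \<phi>\<close>
  is irreducible, but its degree is a product of two numbers greater than \<open>1\<close>.
\<close>

text \<open>The induced module need not be semisimple in characteristic \<open>p\<close>, so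
  \<open>\<sigma>\<close> cannot simply be split off from it. A simple submodule always exists, and
  evaluation at 1 cannot vanish on it, because translation by \<open>G\<close> turns the value at 1
  into every other value. The divisibility of degrees is likewise obtained by counting dimensions,
  without decomposing a restriction to \<open>N\<close>: for a nonzero \<open>N\<close>-map
  \<open>E\<close> from \<open>\<chi>\<close> to \<open>\<sigma>\<close>, the kernels of the
  translates of \<open>E\<close> by elements of \<open>G\<close> are intersected one at a time. Each
  step lowers the dimension by 0 or by the full degree of \<open>\<sigma>\<close>, and the
  intersection over all of \<open>G\<close> is zero. Brauer characters enter only through their
  value at 1, which is the dimension of the representation, and through the fact that a linear
  character is monomial by way of the whole group. Everything in between concerns modules, kept in
  coordinates since representations are matrix-valued.\<close>

no_notation fps_nth (infixl "$" 75)

subsection \<open>Linear maps between coordinate spaces\<close>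

lemma subspace_vec_iff:
  fixes W :: "'k::field vec set"
  shows "subspace class_ring W (module_vec TYPE('k) n) \<longleftrightarrow>
    W \<subseteq> carrier_vec n \<and> 0\<^sub>v n \<in> W \<and> (\<forall>v\<in>W. \<forall>w\<in>W. v + w \<in> W) \<and> (\<forall>c. \<forall>v\<in>W. c \<cdot>\<^sub>v v \<in> W)"
proof -
  have "vectorspace class_ring (module_vec TYPE('k) n)"
    by (rule vec_vs)
  moreover from this have "Module.module class_ring (module_vec TYPE('k) n)"
    by (simp add: vectorspace_def)
  ultimately show ?thesis
    by (auto simp: VectorSpace.subspace_def submodule_def module_vec_simps)
qed

text \<open>Intertwiners are handled as functions rather than matrices because they arise as
  inverses, compositions and column projections. Nothing is demanded of their values outside
  \<open>carrier_vec n\<close>.\<close>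

definition linear_vec :: "nat \<Rightarrow> nat \<Rightarrow> ('k::field vec \<Rightarrow> 'k vec) \<Rightarrow> bool" where
  "linear_vec n m f \<longleftrightarrow>
     (\<forall>v\<in>carrier_vec n. f v \<in> carrier_vec m) \<and>
     (\<forall>v\<in>carrier_vec n. \<forall>w\<in>carrier_vec n. f (v + w) = f v + f w) \<and>
     (\<forall>c. \<forall>v\<in>carrier_vec n. f (c \<cdot>\<^sub>v v) = c \<cdot>\<^sub>v f v)"

lemma linear_vecI:
  assumes "\<And>v. v \<in> carrier_vec n \<Longrightarrow> f v \<in> carrier_vec m"
    and "\<And>v w. v \<in> carrier_vec n \<Longrightarrow> w \<in> carrier_vec n \<Longrightarrow> f (v + w) = f v + f w"
    and "\<And>c v. v \<in> carrier_vec n \<Longrightarrow> f (c \<cdot>\<^sub>v v) = c \<cdot>\<^sub>v f v"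
  shows "linear_vec n m f"
  using assms by (auto simp: linear_vec_def)

lemma linear_vec_closed: "linear_vec n m f \<Longrightarrow> v \<in> carrier_vec n \<Longrightarrow> f v \<in> carrier_vec m"
  and linear_vec_add: "linear_vec n m f \<Longrightarrow> v \<in> carrier_vec n \<Longrightarrow> w \<in> carrier_vec n \<Longrightarrow> f (v + w) = f v + f w"
  and linear_vec_smult: "linear_vec n m f \<Longrightarrow> v \<in> carrier_vec n \<Longrightarrow> f (c \<cdot>\<^sub>v v) = c \<cdot>\<^sub>v f v"
  by (auto simp: linear_vec_def)

lemma zero_smult_vec: "(v::'k::field vec) \<in> carrier_vec n \<Longrightarrow> 0 \<cdot>\<^sub>v v = 0\<^sub>v n"
  by (intro eq_vecI) auto

lemma linear_vec_zero:
  fixes f :: "'k::field vec \<Rightarrow> 'k vec"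
  assumes "linear_vec n m f" shows "f (0\<^sub>v n) = 0\<^sub>v m"
proof -
  have "f (0 \<cdot>\<^sub>v 0\<^sub>v n) = 0 \<cdot>\<^sub>v f (0\<^sub>v n)"
    by (rule linear_vec_smult[OF assms]) simp
  moreover have "f (0\<^sub>v n) \<in> carrier_vec m"
    using assms by (rule linear_vec_closed) simp
  moreover have "0 \<cdot>\<^sub>v 0\<^sub>v n = (0\<^sub>v n :: 'k vec)"
    by (rule zero_smult_vec) simp
  ultimately show ?thesis by (simp add: zero_smult_vec)
qed

lemma minus_vec_conv:
  fixes v w :: "'k::field vec"
  assumes "v \<in> carrier_vec n" "w \<in> carrier_vec n"
  shows "v - w = v + (-1) \<cdot>\<^sub>v w"
  using assms by (intro eq_vecI) auto

lemma minus_add_vec: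
  fixes v w :: "'k::field vec"
  assumes "v \<in> carrier_vec n" "w \<in> carrier_vec n"
  shows "v - w + w = v"
  using assms by (intro eq_vecI) auto

lemma linear_vec_diff:
  assumes "linear_vec n m f" "v \<in> carrier_vec n" "w \<in> carrier_vec n"
  shows "f (v - w) = f v - f w"
  using assms by (simp add: minus_vec_conv[of _ n] minus_vec_conv[of _ m] linear_vec_add linear_vec_smult linear_vec_closed)

lemma diff_vec_eq_zero:
  fixes v w :: "'k::field vec"
  assumes "v \<in> carrier_vec n" "w \<in> carrier_vec n" "v - w = 0\<^sub>v n"
  shows "v = w"
proof (rule eq_vecI)
  show "v $ i = w $ i" if "i < dim_vec w" for i
  proof -
    have "(v - w) $ i = 0" using assms that by simp
    then show ?thesis using assms(1,2) that by simp
  qed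
qed (use assms in auto)

lemma linear_vec_inj_onI:
  assumes "linear_vec n m f" "\<And>v. v \<in> carrier_vec n \<Longrightarrow> f v = 0\<^sub>v m \<Longrightarrow> v = 0\<^sub>v n"
  shows "inj_on f (carrier_vec n)"
proof (rule inj_onI)
  fix v w assume vw: "v \<in> carrier_vec n" "w \<in> carrier_vec n" "f v = f w"
  have "f (v - w) = 0\<^sub>v m"
    using linear_vec_diff[OF assms(1) vw(1,2)] vw linear_vec_closed[OF assms(1)] by simp
  then show "v = w"
    using assms(2)[of "v - w"] vw diff_vec_eq_zero by auto
qed

lemma linear_vec_comp:
  assumes "linear_vec n m f" "linear_vec m l g" shows "linear_vec n l (\<lambda>v. g (f v))"
  using assms by (auto simp: linear_vec_def)

lemma linear_vec_mat:
  "A \<in> carrier_mat m n \<Longrightarrow> linear_vec n m (\<lambda>v. A *\<^sub>v v)"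
  by (intro linear_vecI)
     (auto simp: mult_add_distrib_mat_vec mult_mat_vec)

lemma subspace_kernel:
  assumes "linear_vec n m f"
  shows "subspace class_ring {v \<in> carrier_vec n. f v = 0\<^sub>v m} (module_vec TYPE('k::field) n)"
  using assms linear_vec_zero[OF assms]
  by (auto simp: subspace_vec_iff linear_vec_def)

lemma subspace_image:
  assumes "linear_vec n m f" "subspace class_ring U (module_vec TYPE('k::field) n)"
  shows "subspace class_ring (f ` U) (module_vec TYPE('k) m)"
proof -
  have U: "U \<subseteq> carrier_vec n" "0\<^sub>v n \<in> U" "\<And>v w. v \<in> U \<Longrightarrow> w \<in> U \<Longrightarrow> v + w \<in> U"
    "\<And>c v. v \<in> U \<Longrightarrow> c \<cdot>\<^sub>v v \<in> U"
    using assms(2) by (auto simp: subspace_vec_iff)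
  have "f (v + w) = f v + f w" "f (c \<cdot>\<^sub>v v) = c \<cdot>\<^sub>v f v" if "v \<in> U" "w \<in> U" for v w c
    using that U(1) linear_vec_add[OF assms(1)] linear_vec_smult[OF assms(1)] by blast+
  then show ?thesis
    unfolding subspace_vec_iff
    using U linear_vec_zero[OF assms(1)] linear_vec_closed[OF assms(1)]
    by (auto simp: image_iff Ball_def) metis+
qed

definition matrix_of :: "nat \<Rightarrow> nat \<Rightarrow> ('k::field vec \<Rightarrow> 'k vec) \<Rightarrow> 'k mat" where
  "matrix_of n m f = mat m n (\<lambda>(i, j). f (unit_vec n j) $ i)"

lemma matrix_of_carrier [simp]: "matrix_of n m f \<in> carrier_mat m n"
  by (simp add: matrix_of_def)

lemma matrix_of_unit_vec:
  fixes f :: "'k::field vec \<Rightarrow> 'k vec"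
  assumes "linear_vec n m f" "j < n"
  shows "matrix_of n m f *\<^sub>v unit_vec n j = f (unit_vec n j)"
proof -
  have "f (unit_vec n j) \<in> carrier_vec m"
    using assms(1) by (rule linear_vec_closed) simp
  then show ?thesis
    using assms(2) by (intro eq_vecI) (auto simp: matrix_of_def)
qed

text \<open>This serves as an induction principle: a property that cuts out a subspace need only be
  checked on unit vectors.\<close>

lemma subspace_unit_vecs:
  fixes W :: "'k::field vec set"
  assumes W: "subspace class_ring W (module_vec TYPE('k) n)" and unit: "\<And>j. j < n \<Longrightarrow> unit_vec n j \<in> W"
  shows "W = carrier_vec n"
proof -
  have sub: "W \<subseteq> carrier_vec n" "0\<^sub>v n \<in> W" "\<And>v w. v \<in> W \<Longrightarrow> w \<in> W \<Longrightarrow> v + w \<in> W"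
    "\<And>c v. v \<in> W \<Longrightarrow> c \<cdot>\<^sub>v v \<in> W"
    using W by (auto simp: subspace_vec_iff)
  \<comment> \<open>Here \<open>k\<close> bounds the support of \<open>v\<close>; the induction step
    splits off the multiple of the last unit vector that can occur.\<close>
  have "v \<in> W" if "k \<le> n" "v \<in> carrier_vec n" "\<And>i. k \<le> i \<Longrightarrow> i < n \<Longrightarrow> v $ i = 0" for k v
    using that
  proof (induction k arbitrary: v)
    case 0
    then have "v = 0\<^sub>v n" by (intro eq_vecI) auto
    then show ?case using sub by simp
  next
    case (Suc k)
    define w where "w = vec n (\<lambda>i. if i = k then 0 else v $ i)"
    have "w \<in> W"
      by (rule Suc.IH) (use Suc.prems in \<open>auto simp: w_def\<close>)
    moreover have "v = w + (v $ k) \<cdot>\<^sub>v unit_vec n k"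
      using Suc.prems by (intro eq_vecI) (auto simp: w_def)
    ultimately show ?case using unit[of k] Suc.prems(1) sub(3,4) by (metis Suc_le_eq)
  qed
  from this[of n] sub(1) show ?thesis by auto
qed

lemma subspace_preimage:
  assumes f: "linear_vec n m f" and U: "subspace class_ring U (module_vec TYPE('k::field) m)"
  shows "subspace class_ring {v \<in> carrier_vec n. f v \<in> U} (module_vec TYPE('k) n)"
  using U linear_vec_zero[OF f] linear_vec_add[OF f] linear_vec_smult[OF f]
  by (auto simp: subspace_vec_iff)

lemma linear_vec_in_subspace:
  fixes f :: "'k::field vec \<Rightarrow> 'k vec"
  assumes "linear_vec n m f" "subspace class_ring U (module_vec TYPE('k) m)"
    and "\<And>j. j < n \<Longrightarrow> f (unit_vec n j) \<in> U" "v \<in> carrier_vec n"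
  shows "f v \<in> U"
  using subspace_unit_vecs[OF subspace_preimage[OF assms(1,2)]] assms(3,4) by auto

lemma linear_vec_eqI:
  fixes f :: "'k::field vec \<Rightarrow> 'k vec"
  assumes f: "linear_vec n m f" and g: "linear_vec n m g"
    and eq: "\<And>j. j < n \<Longrightarrow> f (unit_vec n j) = g (unit_vec n j)"
    and v: "v \<in> carrier_vec n"
  shows "f v = g v"
proof -
  have "subspace class_ring {v \<in> carrier_vec n. f v = g v} (module_vec TYPE('k) n)"
    using linear_vec_zero[OF f] linear_vec_zero[OF g] linear_vec_add[OF f] linear_vec_add[OF g]
      linear_vec_smult[OF f] linear_vec_smult[OF g]
    by (auto simp: subspace_vec_iff)
  from subspace_unit_vecs[OF this] show ?thesis
    using eq v by auto
qed

lemma linear_vec_plus: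
  fixes f :: "'k::field vec \<Rightarrow> 'k vec"
  assumes f: "linear_vec n m f" and g: "linear_vec n m g"
  shows "linear_vec n m (\<lambda>v. f v + g v)"
proof (rule linear_vecI)
  have c: "f v \<in> carrier_vec m" "g v \<in> carrier_vec m" if "v \<in> carrier_vec n" for v
    using that f g by (auto simp: linear_vec_def)
  show "f v + g v \<in> carrier_vec m" if "v \<in> carrier_vec n" for v
    using c[OF that] by simp
  show "f (v + w) + g (v + w) = (f v + g v) + (f w + g w)"
    if "v \<in> carrier_vec n" "w \<in> carrier_vec n" for v w
    using c[OF that(1)] c[OF that(2)] that f g
    by (intro eq_vecI) (auto simp: linear_vec_add)
  show "f (a \<cdot>\<^sub>v v) + g (a \<cdot>\<^sub>v v) = a \<cdot>\<^sub>v (f v + g v)" if "v \<in> carrier_vec n" for a v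
    using c[OF that] that f g
    by (intro eq_vecI) (auto simp: linear_vec_smult distrib_left)
qed

lemma linear_vec_first: "linear_vec (b + c) b (\<lambda>v. vec_first v b)"
  and linear_vec_last: "linear_vec (b + c) c (\<lambda>v. vec_last v c)"
  by (auto simp: linear_vec_def vec_first_def vec_last_def)

lemma linear_vec_index:
  assumes "i < n" "w \<in> carrier_vec m"
  shows "linear_vec n m (\<lambda>v. (v $ i) \<cdot>\<^sub>v w)"
proof (rule linear_vecI)
  show "(u + v) $ i \<cdot>\<^sub>v w = u $ i \<cdot>\<^sub>v w + v $ i \<cdot>\<^sub>v w"
    if "u \<in> carrier_vec n" "v \<in> carrier_vec n" for u v
    using that assms by (intro eq_vecI) (auto simp: distrib_right)
  show "(a \<cdot>\<^sub>v v) $ i \<cdot>\<^sub>v w = a \<cdot>\<^sub>v (v $ i \<cdot>\<^sub>v w)" if "v \<in> carrier_vec n" for a v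
    using that assms by (intro eq_vecI) auto
qed (use assms in simp)

lemma matrix_of:
  assumes "linear_vec n m f" "v \<in> carrier_vec n"
  shows "matrix_of n m f *\<^sub>v v = f v"
  by (rule linear_vec_eqI[OF linear_vec_mat assms(1) _ assms(2)])
     (use matrix_of_unit_vec assms(1) in auto)

lemma linear_vec_injective_le:
  fixes f :: "'k::field vec \<Rightarrow> 'k vec"
  assumes f: "linear_vec m n f" and inj: "\<And>v. v \<in> carrier_vec m \<Longrightarrow> f v = 0\<^sub>v n \<Longrightarrow> v = 0\<^sub>v m"
  shows "m \<le> n"
proof (rule ccontr)
  assume "\<not> m \<le> n"
  then have nm: "n < m" by simp
  define A where "A = matrix_of m n f"
  \<comment> \<open>pad with zero rows to a square matrix, which is then singular\<close>
  define B where "B = mat m m (\<lambda>(i, j). if i < n then A $$ (i, j) else 0)"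
  have A: "A \<in> carrier_mat n m" by (simp add: A_def)
  have B: "B \<in> carrier_mat m m" by (simp add: B_def)
  \<comment> \<open>Row \<open>m - 1\<close> of \<open>B\<close> is zero because
    \<open>n < m\<close>, so the transpose kills the last unit vector. Hence
    \<open>det B = 0\<close>, which in turn yields a nonzero kernel vector of \<open>B\<close>
    itself.\<close>
  have "B\<^sup>T *\<^sub>v unit_vec m (m - 1) = 0\<^sub>v m"
    using nm B by (intro eq_vecI) (auto simp: B_def)
  moreover have "unit_vec m (m - 1) \<noteq> (0\<^sub>v m :: 'k vec)"
    using nm by (metis diff_less gr_implies_not_zero index_unit_vec(1) index_zero_vec(1) not_gr_zero
        zero_less_one zero_neq_one)
  ultimately have "det (B\<^sup>T) = 0"
    using B det_0_iff_vec_prod_zero[of "B\<^sup>T" m] by (metis transpose_carrier_mat unit_vec_carrier)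
  then have "det B = 0"
    using B by (simp add: det_transpose)
  then obtain v where v: "v \<in> carrier_vec m" "v \<noteq> 0\<^sub>v m" "B *\<^sub>v v = 0\<^sub>v m"
    using B det_0_iff_vec_prod_zero by blast
  have "(A *\<^sub>v v) $ i = 0" if "i < n" for i
  proof -
    have "row B i = row A i"
      using that nm A by (intro eq_vecI) (auto simp: B_def)
    then show ?thesis
      using arg_cong[OF v(3), of "\<lambda>x. x $ i"] that nm A B by auto
  qed
  then have "f v = 0\<^sub>v n"
    using matrix_of[OF f v(1)] linear_vec_closed[OF f v(1)] A_def by (intro eq_vecI) auto
  with inj v show False by blast
qed

section \<open>Dimension of subspaces and rank-nullity\<close>

text \<open>A coordinate isomorphism takes the place of a basis: it is also what turns a stable
  subspace into a matrix representation of degree \<open>b\<close>. The number \<open>n\<close> only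
  records the ambient space.\<close>

definition has_dim :: "'k::field vec set \<Rightarrow> nat \<Rightarrow> nat \<Rightarrow> bool" where
  "has_dim W n b \<longleftrightarrow> (\<exists>f. linear_vec b n f \<and> bij_betw f (carrier_vec b) W)"

text \<open>The inverse of a coordinate map is defined on \<open>W\<close>, not on a full coordinate
  space, so its linearity is expressed after composition with a linear map \<open>h\<close> into
  \<open>W\<close>.\<close>

lemma linear_vec_inv_into:
  fixes h :: "'k::field vec \<Rightarrow> 'k vec"
  assumes f: "linear_vec b n f" "bij_betw f (carrier_vec b) W"
    and h: "linear_vec m n h" "\<And>v. v \<in> carrier_vec m \<Longrightarrow> h v \<in> W"
  shows "linear_vec m b (\<lambda>v. inv_into (carrier_vec b) f (h v))"
proof -
  let ?g = "inv_into (carrier_vec b) f"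
  have g: "?g w \<in> carrier_vec b" "f (?g w) = w" if "w \<in> W" for w
    using that f(2) by (auto simp: bij_betw_def inv_into_into f_inv_into_f)
  have gf: "?g w = v" if "f v = w" "v \<in> carrier_vec b" for v w
    using that f(2) by (auto simp: bij_betw_def)
  show ?thesis
  proof (rule linear_vecI)
    show "?g (h v) \<in> carrier_vec b" if "v \<in> carrier_vec m" for v
      using that g h by blast
    show "?g (h (v + w)) = ?g (h v) + ?g (h w)" if "v \<in> carrier_vec m" "w \<in> carrier_vec m" for v w
      by (rule gf) (use that f h g in \<open>simp_all add: linear_vec_add\<close>)
    show "?g (h (c \<cdot>\<^sub>v v)) = c \<cdot>\<^sub>v ?g (h v)" if "v \<in> carrier_vec m" for v c
      by (rule gf) (use that f h g in \<open>simp_all add: linear_vec_smult\<close>)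
  qed
qed

text \<open>Coordinates on \<open>W\<close> turn \<open>g\<close> into an injective map between
  coordinate spaces, to which \<open>linear_vec_injective_le\<close> applies. In terms of bases: no
  independent family in \<open>W\<close> is longer than its dimension.\<close>

lemma has_dim_le:
  fixes W :: "'k::field vec set"
  assumes "has_dim W n b" and g: "linear_vec c n g" "inj_on g (carrier_vec c)" "g ` carrier_vec c \<subseteq> W"
  shows "c \<le> b"
proof -
  obtain f where f: "linear_vec b n f" "bij_betw f (carrier_vec b) W"
    using assms(1) by (auto simp: has_dim_def)
  have gW: "g v \<in> W" if "v \<in> carrier_vec c" for v
    using that g by auto
  have lin: "linear_vec c b (\<lambda>v. inv_into (carrier_vec b) f (g v))"
    by (rule linear_vec_inv_into[OF f g(1) gW])
  show ?thesis
  proof (rule linear_vec_injective_le[OF lin])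
    fix v assume v: "v \<in> carrier_vec c" "inv_into (carrier_vec b) f (g v) = 0\<^sub>v b"
    then have "g v = f (0\<^sub>v b)"
      using gW f(2) by (metis bij_betw_def f_inv_into_f)
    also have "\<dots> = g (0\<^sub>v c)"
      using f(1) g(1) by (simp add: linear_vec_zero)
    finally show "v = 0\<^sub>v c"
      using v(1) g(2) by (auto dest: inj_onD)
  qed
qed

lemma has_dim_unique: "has_dim W n b \<Longrightarrow> has_dim W n c \<Longrightarrow> b = c"
  by (metis (no_types, lifting) bij_betw_def has_dim_def has_dim_le order_antisym order_refl)

lemma has_dim_carrier_vec: "has_dim (carrier_vec n) n n"
  unfolding has_dim_def by (intro exI[of _ "\<lambda>v. v"]) (auto simp: linear_vec_def bij_betw_def)

lemma carrier_vec_0: "carrier_vec 0 = {0\<^sub>v 0 :: 'k::field vec}"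
proof
  show "carrier_vec 0 \<subseteq> {0\<^sub>v 0 :: 'k vec}"
    by (auto intro!: eq_vecI)
qed simp

lemma has_dim_0_iff: "has_dim W n 0 \<longleftrightarrow> W = {0\<^sub>v n :: 'k::field vec}"
proof
  assume "has_dim W n 0"
  then obtain f where "linear_vec 0 n f" "W = f ` carrier_vec 0"
    by (auto simp: has_dim_def bij_betw_def)
  then show "W = {0\<^sub>v n}"
    using linear_vec_zero[of 0 n f] by (simp add: carrier_vec_0)
next
  assume "W = {0\<^sub>v n}"
  moreover have "linear_vec 0 n (\<lambda>_. 0\<^sub>v n :: 'k vec)" by (auto simp: linear_vec_def)
  moreover have "bij_betw (\<lambda>_. 0\<^sub>v n) (carrier_vec 0 :: 'k vec set) {0\<^sub>v n :: 'k vec}"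
    unfolding carrier_vec_0 by (simp add: bij_betw_def)
  ultimately show "has_dim W n 0" unfolding has_dim_def by blast
qed

text \<open>An independent family is enlarged by a vector outside its span: the new last coordinate
  is sent to the multiples of \<open>w\<close>.\<close>

lemma extend_injective:
  fixes W :: "'k::field vec set"
  assumes W: "subspace class_ring W (module_vec TYPE('k) n)"
    and f: "linear_vec b n f" "inj_on f (carrier_vec b)" "f ` carrier_vec b \<subseteq> W"
    and w: "w \<in> W" "w \<notin> f ` carrier_vec b"
  obtains g where "linear_vec (Suc b) n g" "inj_on g (carrier_vec (Suc b))" "g ` carrier_vec (Suc b) \<subseteq> W"
proof -
  have sub: "W \<subseteq> carrier_vec n" "0\<^sub>v n \<in> W" "\<And>v w. v \<in> W \<Longrightarrow> w \<in> W \<Longrightarrow> v + w \<in> W"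
    "\<And>c v. v \<in> W \<Longrightarrow> c \<cdot>\<^sub>v v \<in> W"
    using W by (auto simp: subspace_vec_iff)
  define f' where "f' v = f (vec_first v b) + (v $ b) \<cdot>\<^sub>v w" for v
  have wc: "w \<in> carrier_vec n" using w sub by blast
  have fc: "f (vec_first v b) \<in> carrier_vec n" for v
    using f(1) by (simp add: linear_vec_closed)
  have lin: "linear_vec (Suc b) n f'"
    unfolding f'_def using linear_vec_first[of b 1]
    by (intro linear_vec_plus linear_vec_index wc linear_vec_comp[OF _ f(1)]) auto
  have "inj_on f' (carrier_vec (Suc b))"
  proof (rule linear_vec_inj_onI[OF lin])
    fix v :: "'k vec" assume v: "v \<in> carrier_vec (Suc b)" "f' v = 0\<^sub>v n"
    have eq: "f (vec_first v b) $ i + v $ b * w $ i = 0" if "i < n" for i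
      using arg_cong[OF v(2), of "\<lambda>x. x $ i"] that fc[of v] wc by (simp add: f'_def)
    \<comment> \<open>Dividing the relation by a nonzero last coordinate would put \<open>w\<close>
      into the image of \<open>f\<close>.\<close>
    have vb: "v $ b = 0"
    proof (rule ccontr)
      assume nz: "v $ b \<noteq> 0"
      have "w = (- 1 / v $ b) \<cdot>\<^sub>v f (vec_first v b)"
      proof (rule eq_vecI)
        show "w $ i = ((- 1 / v $ b) \<cdot>\<^sub>v f (vec_first v b)) $ i"
          if "i < dim_vec ((- 1 / v $ b) \<cdot>\<^sub>v f (vec_first v b))" for i
        proof -
          have "f (vec_first v b) $ i = - (v $ b * w $ i)"
            using eq[of i] that fc[of v] by (simp add: eq_neg_iff_add_eq_0)
          then show ?thesis
            using that nz by simp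
        qed
      qed (use fc[of v] wc in auto)
      also have "\<dots> = f ((- 1 / v $ b) \<cdot>\<^sub>v vec_first v b)"
        using f(1) by (simp add: linear_vec_smult)
      finally have "w \<in> f ` carrier_vec b"
        by (rule image_eqI) simp
      with w show False by blast
    qed
    have "f (vec_first v b) = f (0\<^sub>v b)"
      using eq fc[of v] vb linear_vec_zero[OF f(1)] by (intro eq_vecI) auto
    then have "vec_first v b = 0\<^sub>v b"
      using f(2) by (auto dest: inj_onD)
    then have "v $ i = 0" if "i < b" for i
      using that by (metis index_vec index_zero_vec(1) vec_first_def)
    with vb v(1) show "v = 0\<^sub>v (Suc b)"
      by (intro eq_vecI) (auto simp: less_Suc_eq)
  qed
  moreover have "f' ` carrier_vec (Suc b) \<subseteq> W"
  proof -
    have "f' v \<in> W" for v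
      unfolding f'_def using f(3) by (intro sub(3,4) w(1)) auto
    then show ?thesis by blast
  qed
  ultimately show thesis
    using lin that by blast
qed

text \<open>Among the injective linear maps into \<open>W\<close>, take one with the largest source;
  the sources are bounded by \<open>n\<close>. If it missed a vector of \<open>W\<close>,
  \<open>extend_injective\<close> would produce a larger one.\<close>

lemma subspace_has_dim:
  fixes W :: "'k::field vec set"
  assumes W: "subspace class_ring W (module_vec TYPE('k) n)"
  obtains b where "has_dim W n b" "b \<le> n"
proof -
  define P where "P b \<longleftrightarrow> (\<exists>f. linear_vec b n f \<and> inj_on f (carrier_vec b) \<and> f ` carrier_vec b \<subseteq> W)" for b
  have sub: "W \<subseteq> carrier_vec n" "0\<^sub>v n \<in> W"
    using W by (auto simp: subspace_vec_iff)
  have bound: "b \<le> n" if "P b" for b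
    using that has_dim_le[OF has_dim_carrier_vec] sub(1) unfolding P_def by blast
  have "P 0"
    using has_dim_0_iff[of "{0\<^sub>v n}" n] sub(2) unfolding P_def has_dim_def bij_betw_def
    by (metis empty_subsetI insert_subset)
  define b where "b = Greatest P"
  have Pb: "P b"
    unfolding b_def using \<open>P 0\<close> bound by (rule GreatestI_nat)
  then obtain f where f: "linear_vec b n f" "inj_on f (carrier_vec b)" "f ` carrier_vec b \<subseteq> W"
    unfolding P_def by blast
  have "W \<subseteq> f ` carrier_vec b"
  proof
    fix w assume "w \<in> W"
    show "w \<in> f ` carrier_vec b"
    proof (rule ccontr)
      assume "w \<notin> f ` carrier_vec b"
      then have "P (Suc b)"
        unfolding P_def using extend_injective[OF W f \<open>w \<in> W\<close>] by metis
      then have "Suc b \<le> b"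
        unfolding b_def using bound by (rule Greatest_le_nat)
      then show False by simp
    qed
  qed
  with f have "has_dim W n b"
    by (auto simp: has_dim_def bij_betw_def)
  with bound[OF Pb] show thesis by (rule that[rotated])
qed

lemma subspace_carrier_vec: "subspace class_ring (carrier_vec n) (module_vec TYPE('k::field) n)"
  by (auto simp: subspace_vec_iff)

text \<open>A missed vector would extend \<open>f\<close> to an injection of a space of dimension
  \<open>Suc n\<close> into one of dimension \<open>n\<close>.\<close>

lemma linear_vec_injective_bij:
  fixes f :: "'k::field vec \<Rightarrow> 'k vec"
  assumes "linear_vec n n f" "inj_on f (carrier_vec n)"
  shows "bij_betw f (carrier_vec n) (carrier_vec n)"
proof -
  have sub: "f ` carrier_vec n \<subseteq> carrier_vec n"
    using linear_vec_closed[OF assms(1)] by blast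
  have "w \<in> f ` carrier_vec n" if wn: "w \<in> carrier_vec n" for w
  proof (rule ccontr)
    assume w: "w \<notin> f ` carrier_vec n"
    obtain g :: "'k vec \<Rightarrow> 'k vec" where "linear_vec (Suc n) n g" "inj_on g (carrier_vec (Suc n))"
      "g ` carrier_vec (Suc n) \<subseteq> carrier_vec n"
      using extend_injective[OF subspace_carrier_vec assms sub wn w] .
    then have "Suc n \<le> n"
      by (rule has_dim_le[OF has_dim_carrier_vec])
    then show False by simp
  qed
  with sub assms(2) show ?thesis
    by (auto simp: bij_betw_def)
qed

lemma has_dim_eq_carrier_vec:
  assumes "has_dim W n n"
  shows "W = carrier_vec n"
proof -
  obtain f where "linear_vec n n f" "bij_betw f (carrier_vec n) W"
    using assms by (auto simp: has_dim_def)
  then show ?thesis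
    using linear_vec_injective_bij[of n f] by (simp add: bij_betw_def)
qed

lemma vec_first_append: "v \<in> carrier_vec b \<Longrightarrow> vec_first (v @\<^sub>v w) b = v"
  and vec_last_append: "w \<in> carrier_vec c \<Longrightarrow> vec_last (v @\<^sub>v w) c = w"
  by (auto simp: vec_first_def vec_last_def intro!: eq_vecI)

text \<open>A linear section of \<open>f\<close> splits \<open>U\<close> into the kernel and a copy
  of the target, and \<open>g\<close> glues coordinates on the two summands. In the applications,
  irreducibility of the target supplies surjectivity onto a full coordinate space.\<close>

lemma rank_nullity:
  fixes U :: "'k::field vec set"
  assumes U: "subspace class_ring U (module_vec TYPE('k) n)" "has_dim U n b"
    and f: "linear_vec n d f" "f ` U = carrier_vec d"
    and K: "has_dim {u \<in> U. f u = 0\<^sub>v d} n c"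
  shows "b = c + d"
proof -
  have sub: "U \<subseteq> carrier_vec n" "0\<^sub>v n \<in> U" "\<And>v w. v \<in> U \<Longrightarrow> w \<in> U \<Longrightarrow> v + w \<in> U"
    "\<And>c v. v \<in> U \<Longrightarrow> c \<cdot>\<^sub>v v \<in> U"
    using U by (auto simp: subspace_vec_iff)
  have sub_diff: "v - w \<in> U" if "v \<in> U" "w \<in> U" for v w
  proof -
    have "v - w = v + (-1) \<cdot>\<^sub>v w"
      using that sub(1) by (intro minus_vec_conv) auto
    then show ?thesis
      using sub(3)[OF that(1) sub(4)[OF that(2)]] by (simp only:)
  qed
  obtain k where k: "linear_vec c n k" "bij_betw k (carrier_vec c) {u \<in> U. f u = 0\<^sub>v d}"
    using K by (auto simp: has_dim_def)
  have kU: "k v \<in> U" "f (k v) = 0\<^sub>v d" if "v \<in> carrier_vec c" for v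
    using k(2) that by (auto simp: bij_betw_def)
  define e where "e j = (SOME u. u \<in> U \<and> f u = unit_vec d j)" for j
  have e: "e j \<in> U" "f (e j) = unit_vec d j" for j
  proof -
    have "unit_vec d j \<in> f ` U" using f(2) by simp
    then have "\<exists>u. u \<in> U \<and> f u = unit_vec d j" by (auto simp: image_iff)
    then show "e j \<in> U" "f (e j) = unit_vec d j"
      unfolding e_def by (metis (mono_tags, lifting) someI_ex)+
  qed
  \<comment> \<open>The columns of \<open>R\<close> are chosen preimages in \<open>U\<close> of the
    unit vectors, so multiplication by \<open>R\<close> is a linear section of \<open>f\<close> with
    values in \<open>U\<close>.\<close>
  define R where "R = mat n d (\<lambda>(i, j). e j $ i)"
  have R: "R \<in> carrier_mat n d" by (simp add: R_def)
  have Re: "R *\<^sub>v unit_vec d j = e j" if "j < d" for j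
    using that e(1)[of j] sub(1) by (intro eq_vecI) (auto simp: R_def)
  have fR: "f (R *\<^sub>v v) = v" if "v \<in> carrier_vec d" for v
  proof (rule linear_vec_eqI[OF linear_vec_comp[OF linear_vec_mat[OF R] f(1)] _ _ that])
    show "linear_vec d d (\<lambda>v. v)" by (auto simp: linear_vec_def)
  qed (simp add: Re e)
  have RU: "R *\<^sub>v v \<in> U" if "v \<in> carrier_vec d" for v
    by (rule linear_vec_in_subspace[OF linear_vec_mat[OF R] U(1) _ that]) (simp add: Re e)
  define g where "g v = k (vec_first v c) + R *\<^sub>v vec_last v d" for v
  have lin: "linear_vec (c + d) n g"
    unfolding g_def
    by (intro linear_vec_plus linear_vec_comp[OF linear_vec_first k(1)]
        linear_vec_comp[OF linear_vec_last linear_vec_mat[OF R]])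
  have fg: "f (g v) = vec_last v d" for v
  proof -
    have "f (g v) = f (k (vec_first v c)) + f (R *\<^sub>v vec_last v d)"
      unfolding g_def using kU(1)[of "vec_first v c"] RU[of "vec_last v d"] sub(1)
      by (intro linear_vec_add[OF f(1)]) auto
    then show ?thesis using kU(2) fR by simp
  qed
  have "inj_on g (carrier_vec (c + d))"
  proof (rule linear_vec_inj_onI[OF lin])
    fix v :: "'k vec" assume v: "v \<in> carrier_vec (c + d)" "g v = 0\<^sub>v n"
    then have last: "vec_last v d = 0\<^sub>v d"
      using fg[of v] linear_vec_zero[OF f(1)] by simp
    have "R *\<^sub>v 0\<^sub>v d = 0\<^sub>v n"
      using linear_vec_zero[OF linear_vec_mat[OF R]] .
    moreover have "k (vec_first v c) \<in> carrier_vec n"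
      using kU(1)[of "vec_first v c"] sub(1) by auto
    ultimately have "k (vec_first v c) = k (0\<^sub>v c)"
      using v(2) linear_vec_zero[OF k(1)] by (simp add: g_def last)
    then have "vec_first v c = 0\<^sub>v c"
      using k(2) by (auto simp: bij_betw_def dest: inj_onD)
    then have "v = 0\<^sub>v c @\<^sub>v 0\<^sub>v d"
      using vec_first_last_append[OF v(1)] last by (simp only:)
    also have "\<dots> = 0\<^sub>v (c + d)"
      by (intro eq_vecI) auto
    finally show "v = 0\<^sub>v (c + d)" .
  qed
  moreover have "g ` carrier_vec (c + d) = U"
  proof
    have "g v \<in> U" for v
      unfolding g_def using kU(1) RU by (intro sub(3)) auto
    then show "g ` carrier_vec (c + d) \<subseteq> U" by blast
    show "U \<subseteq> g ` carrier_vec (c + d)"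
    proof
      fix u assume u: "u \<in> U"
      have fu: "f u \<in> carrier_vec d" using u f(2) by blast
      \<comment> \<open>This is the kernel component of \<open>u\<close>.\<close>
      define r where "r = u - R *\<^sub>v f u"
      have rU: "r \<in> U" unfolding r_def by (intro sub_diff u RU fu)
      have "f r = f u - f (R *\<^sub>v f u)"
        unfolding r_def using u RU[OF fu] sub(1) by (intro linear_vec_diff[OF f(1)]) auto
      then have "f r = 0\<^sub>v d" using fR[OF fu] fu by simp
      with rU have "r \<in> k ` carrier_vec c"
        using k(2) by (simp add: bij_betw_def)
      then obtain w where w: "w \<in> carrier_vec c" "k w = r"
        by blast
      have "vec_first (w @\<^sub>v f u) c = w" "vec_last (w @\<^sub>v f u) d = f u"
        using vec_first_append[OF w(1)] vec_last_append[OF fu] by simp_all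
      then have "g (w @\<^sub>v f u) = r + R *\<^sub>v f u"
        by (simp add: g_def w)
      also have "\<dots> = u"
        unfolding r_def using u RU[OF fu] sub(1) by (intro minus_add_vec) auto
      finally show "u \<in> g ` carrier_vec (c + d)"
        by (rule image_eqI[OF sym]) (rule append_carrier_vec[OF w(1) fu])
    qed
  qed
  ultimately have "has_dim U n (c + d)"
    using lin by (auto simp: has_dim_def bij_betw_def)
  with U(2) show ?thesis by (rule has_dim_unique)
qed

subsection \<open>Representations and Schur's lemma\<close>

lemma representation_iff:
  fixes \<rho> :: "'a \<Rightarrow> 'k::alg_closed_field mat"
  assumes "group G"
  shows "representation G n \<rho> \<longleftrightarrow> 0 < n \<and> (\<forall>g\<in>carrier G. \<rho> g \<in> carrier_mat n n) \<and> \<rho> \<one>\<^bsub>G\<^esub> = 1\<^sub>m n \<and>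
    (\<forall>g\<in>carrier G. \<forall>h\<in>carrier G. \<rho> (g \<otimes>\<^bsub>G\<^esub> h) = \<rho> g * \<rho> h)"
    (is "_ \<longleftrightarrow> ?R")
proof
  interpret group G by fact
  let ?M = "ring_mat TYPE('k) n ()"
  interpret M: ring ?M by (rule ring_mat)
  interpret U: group "units_of ?M" by (rule M.units_group)
  have carr: "carrier (units_of ?M) \<subseteq> carrier_mat n n"
    by (auto simp: units_of_def Units_def ring_mat_simps)
  show ?R if rep: "representation G n \<rho>"
  proof -
    have hom: "\<rho> \<in> hom G (units_of ?M)" and n: "0 < n"
      using rep by (auto simp: representation_def)
    interpret h: group_hom G "units_of ?M" \<rho>
      by unfold_locales (rule hom)
    have "\<rho> \<one>\<^bsub>G\<^esub> = 1\<^sub>m n"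
      using h.hom_one by (simp add: units_of_def ring_mat_simps)
    moreover have "\<rho> (g \<otimes>\<^bsub>G\<^esub> h) = \<rho> g * \<rho> h" if "g \<in> carrier G" "h \<in> carrier G" for g h
      using h.hom_mult[OF that] by (simp add: units_of_def ring_mat_simps)
    ultimately show ?R
      using n carr h.hom_closed by blast
  qed
  show "representation G n \<rho>" if R: ?R
  proof -
    have "\<rho> g \<in> Units ?M" if g: "g \<in> carrier G" for g
    proof -
      have "\<rho> g * \<rho> (inv\<^bsub>G\<^esub> g) = 1\<^sub>m n" "\<rho> (inv\<^bsub>G\<^esub> g) * \<rho> g = 1\<^sub>m n"
        using R g by (metis inv_closed r_inv, metis inv_closed l_inv)
      then show ?thesis
        using R g by (auto simp: Units_def ring_mat_simps intro!: bexI[of _ "\<rho> (inv\<^bsub>G\<^esub> g)"])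
    qed
    then show ?thesis
      using R by (auto simp: representation_def hom_def units_of_def ring_mat_simps)
  qed
qed

lemma representation_vec:
  assumes "group G" "representation G n \<rho>" "v \<in> carrier_vec n"
  shows "g \<in> carrier G \<Longrightarrow> \<rho> g *\<^sub>v v \<in> carrier_vec n"
    and "\<rho> \<one>\<^bsub>G\<^esub> *\<^sub>v v = v"
    and "g \<in> carrier G \<Longrightarrow> h \<in> carrier G \<Longrightarrow> \<rho> (g \<otimes>\<^bsub>G\<^esub> h) *\<^sub>v v = \<rho> g *\<^sub>v (\<rho> h *\<^sub>v v)"
  using assms by (auto simp: representation_iff assoc_mult_mat_vec[of _ n n _ n])

lemma representation_linear:
  assumes "group G" "representation G n \<rho>" "g \<in> carrier G"
  shows "linear_vec n n (\<lambda>v. \<rho> g *\<^sub>v v)"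
  using assms by (intro linear_vec_mat) (auto simp: representation_iff)

lemma irreducible_representationD:
  assumes "irreducible_representation G n \<rho>"
  shows "representation G n \<rho>"
    and "subspace class_ring W (module_vec TYPE('k::alg_closed_field) n) \<Longrightarrow>
      (\<And>g w. g \<in> carrier G \<Longrightarrow> w \<in> W \<Longrightarrow> \<rho> g *\<^sub>v w \<in> W) \<Longrightarrow> W = {0\<^sub>v n} \<or> W = carrier_vec n"
  using assms by (auto simp: irreducible_representation_def)

lemma mat_eqI_mult_vec:
  fixes A :: "'k::field mat"
  assumes "A \<in> carrier_mat m n" "B \<in> carrier_mat m n"
    and "\<And>v. v \<in> carrier_vec n \<Longrightarrow> A *\<^sub>v v = B *\<^sub>v v"
  shows "A = B"
proof (rule mat_col_eqI)
  fix j assume "j < dim_col B"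
  then have j: "j < n" using assms by simp
  have "A *\<^sub>v unit_vec n j = col A j" "B *\<^sub>v unit_vec n j = col B j"
    using assms(1,2) j by (auto intro!: eq_vecI)
  then show "col A j = col B j" using assms(3)[of "unit_vec n j"] by simp
qed (use assms in auto)

text \<open>The bijection \<open>f\<close> chooses coordinates on an arbitrary set \<open>W\<close>, thereby making it a vector space.\<close>

lemma representation_of_action:
  fixes f :: "'k::alg_closed_field vec \<Rightarrow> 'c"
  assumes G: "group G" and n: "0 < n" and f: "bij_betw f (carrier_vec n) W"
    and TW: "\<And>g w. g \<in> carrier G \<Longrightarrow> w \<in> W \<Longrightarrow> T g w \<in> W"
    and lin: "\<And>g. g \<in> carrier G \<Longrightarrow> linear_vec n n (\<lambda>v. inv_into (carrier_vec n) f (T g (f v)))"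
    and T1: "\<And>w. w \<in> W \<Longrightarrow> T \<one>\<^bsub>G\<^esub> w = w"
    and Tm: "\<And>g h w. g \<in> carrier G \<Longrightarrow> h \<in> carrier G \<Longrightarrow> w \<in> W \<Longrightarrow> T (g \<otimes>\<^bsub>G\<^esub> h) w = T g (T h w)"
  obtains \<rho> where "representation G n \<rho>"
    "\<And>g v. g \<in> carrier G \<Longrightarrow> v \<in> carrier_vec n \<Longrightarrow> f (\<rho> g *\<^sub>v v) = T g (f v)"
proof -
  interpret group G by fact
  define \<rho> where "\<rho> g = matrix_of n n (\<lambda>v. inv_into (carrier_vec n) f (T g (f v)))" for g
  have fW: "f v \<in> W" if "v \<in> carrier_vec n" for v
    using f that by (auto simp: bij_betw_def)
  have \<rho>: "\<rho> g \<in> carrier_mat n n" for g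
    by (simp add: \<rho>_def)
  have \<rho>v: "f (\<rho> g *\<^sub>v v) = T g (f v)" if "g \<in> carrier G" "v \<in> carrier_vec n" for g v
    using that f TW fW by (simp add: \<rho>_def matrix_of[OF lin] bij_betw_inv_into_right)
  have inj: "v = w" if "f v = f w" "v \<in> carrier_vec n" "w \<in> carrier_vec n" for v w
    using f that by (auto simp: bij_betw_def dest: inj_onD)
  have "\<rho> \<one>\<^bsub>G\<^esub> = 1\<^sub>m n"
  proof (rule mat_eqI_mult_vec[OF \<rho>])
    fix v :: "'k vec" assume v: "v \<in> carrier_vec n"
    have "\<rho> \<one>\<^bsub>G\<^esub> *\<^sub>v v \<in> carrier_vec n"
      by (rule mult_mat_vec_carrier[OF \<rho> v])
    then show "\<rho> \<one>\<^bsub>G\<^esub> *\<^sub>v v = 1\<^sub>m n *\<^sub>v v"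
      using v fW T1 by (auto intro!: inj simp: \<rho>v)
  qed simp
  moreover have "\<rho> (g \<otimes>\<^bsub>G\<^esub> h) = \<rho> g * \<rho> h" if "g \<in> carrier G" "h \<in> carrier G" for g h
  proof (rule mat_eqI_mult_vec[OF \<rho>])
    show "\<rho> g * \<rho> h \<in> carrier_mat n n" by (rule mult_carrier_mat[OF \<rho> \<rho>])
    fix v :: "'k vec" assume v: "v \<in> carrier_vec n"
    have hv: "\<rho> h *\<^sub>v v \<in> carrier_vec n" by (rule mult_mat_vec_carrier[OF \<rho> v])
    have "f (\<rho> (g \<otimes>\<^bsub>G\<^esub> h) *\<^sub>v v) = f (\<rho> g *\<^sub>v (\<rho> h *\<^sub>v v))"
      using that v hv by (simp add: \<rho>v Tm fW)
    then have "\<rho> (g \<otimes>\<^bsub>G\<^esub> h) *\<^sub>v v = \<rho> g *\<^sub>v (\<rho> h *\<^sub>v v)"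
      by (rule inj) (intro mult_mat_vec_carrier[OF \<rho>] v)+
    then show "\<rho> (g \<otimes>\<^bsub>G\<^esub> h) *\<^sub>v v = (\<rho> g * \<rho> h) *\<^sub>v v"
      using assoc_mult_mat_vec[OF \<rho> \<rho> v] by simp
  qed
  ultimately have "representation G n \<rho>"
    using n \<rho> by (auto simp: representation_iff[OF G])
  from this \<rho>v show thesis by (rule that)
qed

text \<open>A nonzero stable subspace of least dimension inside \<open>U\<close> is simple. The
  coordinate map \<open>f\<close> is returned as well, because the simple module has to be a matrix
  representation of its own degree \<open>m\<close>.\<close>

lemma irreducible_subrepresentation:
  fixes \<rho> :: "'a \<Rightarrow> 'k::alg_closed_field mat"
  assumes G: "group G" and \<rho>: "representation G n \<rho>"
    and U: "subspace class_ring U (module_vec TYPE('k) n)" "U \<noteq> {0\<^sub>v n}"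
    and stable: "\<And>g u. g \<in> carrier G \<Longrightarrow> u \<in> U \<Longrightarrow> \<rho> g *\<^sub>v u \<in> U"
  obtains m \<tau> f where "irreducible_representation G m \<tau>" "linear_vec m n f" "inj_on f (carrier_vec m)"
    "f ` carrier_vec m \<subseteq> U"
    "\<And>g v. g \<in> carrier G \<Longrightarrow> v \<in> carrier_vec m \<Longrightarrow> f (\<tau> g *\<^sub>v v) = \<rho> g *\<^sub>v f v"
proof -
  define P where "P m W \<longleftrightarrow> 0 < m \<and> subspace class_ring W (module_vec TYPE('k) n) \<and> W \<subseteq> U \<and>
    has_dim W n m \<and> (\<forall>g\<in>carrier G. \<forall>w\<in>W. \<rho> g *\<^sub>v w \<in> W)" for m W
  have pos: "0 < b" if "W \<noteq> {0\<^sub>v k}" "has_dim W k b" for W :: "'k vec set" and k b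
    using that has_dim_0_iff by (cases b) auto
  have "\<exists>m W. P m W"
    using subspace_has_dim[OF U(1)] pos[OF U(2)] U(1) stable unfolding P_def by (metis order_refl)
  define m where "m = (LEAST m. \<exists>W. P m W)"
  obtain W where W: "P m W"
    using LeastI_ex[OF \<open>\<exists>m W. P m W\<close>] unfolding m_def by blast
  have least: "m \<le> m'" if "P m' W'" for m' W'
    unfolding m_def using that by (intro Least_le) blast
  obtain f where f: "linear_vec m n f" "bij_betw f (carrier_vec m) W"
    using W by (auto simp: P_def has_dim_def)
  have W': "0 < m" "subspace class_ring W (module_vec TYPE('k) n)" "W \<subseteq> U"
    "\<And>g w. g \<in> carrier G \<Longrightarrow> w \<in> W \<Longrightarrow> \<rho> g *\<^sub>v w \<in> W"
    using W by (auto simp: P_def)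
  have Wn: "W \<subseteq> carrier_vec n" using W'(2) by (simp add: subspace_vec_iff)
  have fW: "f v \<in> W" if "v \<in> carrier_vec m" for v
    using f that by (auto simp: bij_betw_def)
  obtain \<tau> where \<tau>: "representation G m \<tau>"
    "\<And>g v. g \<in> carrier G \<Longrightarrow> v \<in> carrier_vec m \<Longrightarrow> f (\<tau> g *\<^sub>v v) = \<rho> g *\<^sub>v f v"
  proof (rule representation_of_action[OF G W'(1) f(2), of "\<lambda>g v. \<rho> g *\<^sub>v v"])
    show "linear_vec m m (\<lambda>v. inv_into (carrier_vec m) f (\<rho> g *\<^sub>v f v))" if "g \<in> carrier G" for g
      by (rule linear_vec_inv_into[OF f linear_vec_comp[OF f(1) representation_linear[OF G \<rho> that]]])
         (use that fW W' in blast)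
  qed (use representation_vec[OF G \<rho>] Wn W' in \<open>auto simp: subset_iff\<close>)
  have "irreducible_representation G m \<tau>"
    unfolding irreducible_representation_def
  proof (intro conjI allI impI \<tau>(1))
    fix Z assume "subspace class_ring Z (module_vec TYPE('k) m) \<and> (\<forall>g\<in>carrier G. \<forall>w\<in>Z. \<tau> g *\<^sub>v w \<in> Z)"
    then have Z: "subspace class_ring Z (module_vec TYPE('k) m)"
      "\<And>g w. g \<in> carrier G \<Longrightarrow> w \<in> Z \<Longrightarrow> \<tau> g *\<^sub>v w \<in> Z" by auto
    have Zm: "Z \<subseteq> carrier_vec m" using Z(1) by (simp add: subspace_vec_iff)
    show "Z = {0\<^sub>v m} \<or> Z = carrier_vec m"
    proof (cases "Z = {0\<^sub>v m}")
      case False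
      then have "Z \<noteq> {0\<^sub>v m}" .
      obtain b where b: "has_dim Z m b" "b \<le> m"
        using subspace_has_dim[OF Z(1)] .
      then obtain h where h: "linear_vec b m h" "bij_betw h (carrier_vec b) Z"
        by (auto simp: has_dim_def)
      \<comment> \<open>The image of \<open>Z\<close> is again a nonzero stable subspace of
        \<open>U\<close>, now of dimension \<open>b\<close>; minimality of \<open>m\<close>
        therefore forces \<open>b = m\<close>.\<close>
      have "bij_betw (\<lambda>v. f (h v)) (carrier_vec b) (f ` Z)"
        using bij_betw_trans[OF h(2), of f "f ` Z"] f(2) Zm
        by (auto simp: bij_betw_def comp_def intro: inj_on_subset)
      then have "has_dim (f ` Z) n b"
        using linear_vec_comp[OF h(1) f(1)] by (auto simp: has_dim_def)
      moreover have "f ` Z \<subseteq> U"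
        using Zm fW W'(3) by blast
      moreover have "\<rho> g *\<^sub>v w \<in> f ` Z" if g: "g \<in> carrier G" and w: "w \<in> f ` Z" for g w
      proof -
        obtain z where z: "z \<in> Z" "w = f z" using w by blast
        then have "\<rho> g *\<^sub>v w = f (\<tau> g *\<^sub>v z)"
          using \<tau>(2)[OF g, of z] Zm by auto
        then show ?thesis using Z(2)[OF g z(1)] by blast
      qed
      ultimately have "P b (f ` Z)"
        using subspace_image[OF f(1) Z(1)] pos[OF \<open>Z \<noteq> {0\<^sub>v m}\<close> b(1)] by (auto simp: P_def)
      then have "b = m" using least b(2) by (metis order_antisym)
      with b(1) show ?thesis
        using has_dim_eq_carrier_vec by blast
    qed simp
  qed
  moreover have "inj_on f (carrier_vec m)" "f ` carrier_vec m \<subseteq> U"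
    using f(2) W'(3) by (auto simp: bij_betw_def)
  ultimately show thesis
    using f(1) \<tau>(2) by (intro that)
qed

lemma intertwiner_image:
  fixes \<rho> :: "'a \<Rightarrow> 'k::alg_closed_field mat"
  assumes G: "group G" and \<rho>: "representation G n \<rho>" and \<sigma>: "irreducible_representation G m \<sigma>"
    and f: "linear_vec n m f" "\<And>g v. g \<in> carrier G \<Longrightarrow> v \<in> U \<Longrightarrow> f (\<rho> g *\<^sub>v v) = \<sigma> g *\<^sub>v f v"
    and U: "subspace class_ring U (module_vec TYPE('k) n)"
      "\<And>g v. g \<in> carrier G \<Longrightarrow> v \<in> U \<Longrightarrow> \<rho> g *\<^sub>v v \<in> U"
  shows "f ` U = {0\<^sub>v m} \<or> f ` U = carrier_vec m"
proof (rule irreducible_representationD(2)[OF \<sigma> subspace_image[OF f(1) U(1)]])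
  show "\<sigma> g *\<^sub>v w \<in> f ` U" if g: "g \<in> carrier G" and w: "w \<in> f ` U" for g w
  proof -
    obtain u where u: "u \<in> U" "w = f u" using w by blast
    then have "\<sigma> g *\<^sub>v w = f (\<rho> g *\<^sub>v u)" using f(2)[OF g] by simp
    then show ?thesis using U(2)[OF g u(1)] by blast
  qed
qed

text \<open>The image and the kernel of \<open>f\<close> are stable subspaces of irreducible
  modules, and \<open>v0\<close> rules out the zero map.\<close>

lemma schur_bij:
  fixes \<rho> :: "'a \<Rightarrow> 'k::alg_closed_field mat"
  assumes G: "group G" and \<rho>: "irreducible_representation G n \<rho>" and \<sigma>: "irreducible_representation G m \<sigma>"
    and f: "linear_vec n m f"
      "\<And>g v. g \<in> carrier G \<Longrightarrow> v \<in> carrier_vec n \<Longrightarrow> f (\<rho> g *\<^sub>v v) = \<sigma> g *\<^sub>v f v"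
    and nz: "v0 \<in> carrier_vec n" "f v0 \<noteq> 0\<^sub>v m"
  shows "bij_betw f (carrier_vec n) (carrier_vec m)"
proof -
  note rep = irreducible_representationD(1)[OF \<rho>] irreducible_representationD(1)[OF \<sigma>]
  have "f ` carrier_vec n = carrier_vec m"
    using intertwiner_image[OF G rep(1) \<sigma> f subspace_carrier_vec] representation_vec(1)[OF G rep(1)] nz
    by blast
  moreover have "{v \<in> carrier_vec n. f v = 0\<^sub>v m} = {0\<^sub>v n} \<or> {v \<in> carrier_vec n. f v = 0\<^sub>v m} = carrier_vec n"
  proof (rule irreducible_representationD(2)[OF \<rho> subspace_kernel[OF f(1)]])
    fix g w assume g: "g \<in> carrier G" "w \<in> {v \<in> carrier_vec n. f v = 0\<^sub>v m}"
    then show "\<rho> g *\<^sub>v w \<in> {v \<in> carrier_vec n. f v = 0\<^sub>v m}"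
      using f(2) representation_vec(1)[OF G rep(1)] linear_vec_zero[OF representation_linear[OF G rep(2) g(1)]]
      by auto
  qed
  then have "inj_on f (carrier_vec n)"
    using nz by (intro linear_vec_inj_onI[OF f(1)]) blast
  ultimately show ?thesis by (simp add: bij_betw_def)
qed

text \<open>Algebraic closedness provides an eigenvalue \<open>c\<close> of \<open>f\<close>. Its
  eigenspace is stable because \<open>f\<close> commutes with the action, and it is nonzero, hence
  everything.\<close>

lemma schur_scalar:
  fixes \<rho> :: "'a \<Rightarrow> 'k::alg_closed_field mat"
  assumes G: "group G" and \<rho>: "irreducible_representation G n \<rho>"
    and f: "linear_vec n n f"
      "\<And>g v. g \<in> carrier G \<Longrightarrow> v \<in> carrier_vec n \<Longrightarrow> f (\<rho> g *\<^sub>v v) = \<rho> g *\<^sub>v f v"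
  obtains c where "\<And>v. v \<in> carrier_vec n \<Longrightarrow> f v = c \<cdot>\<^sub>v v"
proof -
  note rep = irreducible_representationD(1)[OF \<rho>]
  have n: "0 < n" using rep by (simp add: representation_def)
  define A where "A = matrix_of n n f"
  have A: "A \<in> carrier_mat n n" by (simp add: A_def)
  have "degree (char_poly A) = n" using degree_monic_char_poly[OF A] by simp
  then obtain c where "poly (char_poly A) c = 0"
    using n alg_closed_imp_poly_has_root[of "char_poly A"] by auto
  then obtain v0 where v0: "v0 \<in> carrier_vec n" "v0 \<noteq> 0\<^sub>v n" "f v0 = c \<cdot>\<^sub>v v0"
    using eigenvalue_root_char_poly[OF A, of c] A matrix_of[OF f(1)]
    unfolding eigenvalue_def eigenvector_def A_def by auto
  let ?W = "{v \<in> carrier_vec n. f v = c \<cdot>\<^sub>v v}"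
  have "?W = {0\<^sub>v n} \<or> ?W = carrier_vec n"
  proof (rule irreducible_representationD(2)[OF \<rho>])
    show "subspace class_ring ?W (module_vec TYPE('k) n)"
      using linear_vec_zero[OF f(1)] linear_vec_add[OF f(1)] linear_vec_smult[OF f(1)]
      by (auto simp: subspace_vec_iff smult_add_distrib_vec smult_smult_assoc mult.commute)
    show "\<rho> g *\<^sub>v w \<in> ?W" if "g \<in> carrier G" "w \<in> ?W" for g w
      using that f(2) representation_vec(1)[OF G rep] linear_vec_smult[OF representation_linear[OF G rep]]
      by auto
  qed
  with v0 have "?W = carrier_vec n" by blast
  then show thesis by (intro that[of c]) blast
qed

subsection \<open>Restriction to a normal subgroup\<close>

lemma representation_restrict:
  assumes "group G" "subgroup N G" "representation G n \<rho>"
  shows "representation (G\<lparr>carrier := N\<rparr>) n \<rho>"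
  using assms subgroup.subset[OF assms(2)] group.subgroup_imp_group[OF assms(1,2)]
  by (auto simp: representation_iff subset_iff)

text \<open>The setting of Clifford's theorem, with \<open>E\<close> a nonzero
  \<open>N\<close>-homomorphism from the restriction of \<open>\<rho>\<close> to
  \<open>\<sigma>\<close>. Having \<open>\<sigma>\<close> as a quotient rather than as a submodule
  fits the induced module, where evaluation at 1 is such a map.\<close>

locale intertwined_representations =
  fixes G :: "('a, 'b) monoid_scheme" (structure) and N :: "'a set"
    and \<rho> \<sigma> :: "'a \<Rightarrow> 'k::alg_closed_field mat" and m d :: nat and E :: "'k vec \<Rightarrow> 'k vec"
  assumes fin: "finite (carrier G)" and N: "N \<lhd> G"
    and \<rho>: "irreducible_representation G m \<rho>"
    and \<sigma>: "irreducible_representation (G\<lparr>carrier := N\<rparr>) d \<sigma>"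
    and E: "linear_vec m d E"
    and equivariant: "\<And>n v. n \<in> N \<Longrightarrow> v \<in> carrier_vec m \<Longrightarrow> E (\<rho> n *\<^sub>v v) = \<sigma> n *\<^sub>v E v"
    and nonzero: "\<exists>v\<in>carrier_vec m. E v \<noteq> 0\<^sub>v d"
begin

sublocale normal N G by (rule N)

lemmas N_group = subgroup_imp_group[OF subgroup_axioms]
lemmas \<rho>_rep = irreducible_representationD(1)[OF \<rho>]
lemmas \<sigma>_rep = irreducible_representationD(1)[OF \<sigma>]
lemmas \<rho>_vec = representation_vec[OF is_group \<rho>_rep]

text \<open>The common kernel of the translates of \<open>E\<close> by the elements of
  \<open>S\<close>. As \<open>S\<close> grows from the empty set to all of \<open>G\<close>, it
  descends from the whole space to zero.\<close>

definition kernel_of :: "'a set \<Rightarrow> 'k vec set" where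
  "kernel_of S = {v \<in> carrier_vec m. \<forall>x\<in>S. E (\<rho> x *\<^sub>v v) = 0\<^sub>v d}"

lemma linear_at: "x \<in> carrier G \<Longrightarrow> linear_vec m d (\<lambda>v. E (\<rho> x *\<^sub>v v))"
  by (rule linear_vec_comp[OF representation_linear[OF is_group \<rho>_rep] E])

lemma conj_in: "x \<in> carrier G \<Longrightarrow> n \<in> N \<Longrightarrow> x \<otimes> n \<otimes> inv x \<in> N" "x \<in> carrier G \<Longrightarrow> n \<in> N \<Longrightarrow> inv x \<otimes> n \<otimes> x \<in> N"
  using inv_op_closed1 inv_op_closed2 by auto

text \<open>The translate of \<open>E\<close> by \<open>x\<close> is an
  \<open>N\<close>-homomorphism to the conjugate of \<open>\<sigma>\<close> by \<open>x\<close>,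
  since \<open>x n\<close> equals \<open>(x n x^-1) x\<close>.\<close>

lemma E_conj:
  assumes "x \<in> carrier G" "n \<in> N" "v \<in> carrier_vec m"
  shows "E (\<rho> x *\<^sub>v (\<rho> n *\<^sub>v v)) = \<sigma> (x \<otimes> n \<otimes> inv x) *\<^sub>v E (\<rho> x *\<^sub>v v)"
proof -
  have n: "n \<in> carrier G" using assms by simp
  have "\<rho> x *\<^sub>v (\<rho> n *\<^sub>v v) = \<rho> ((x \<otimes> n \<otimes> inv x) \<otimes> x) *\<^sub>v v"
    using assms n by (simp add: \<rho>_vec(3)[symmetric] m_assoc)
  also have "\<dots> = \<rho> (x \<otimes> n \<otimes> inv x) *\<^sub>v (\<rho> x *\<^sub>v v)"
    using assms n by (simp add: \<rho>_vec(3))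
  finally show ?thesis
    using equivariant[OF conj_in(1)[OF assms(1,2)]] \<rho>_vec(1) assms by simp
qed

lemma kernel_of_subspace:
  assumes "S \<subseteq> carrier G"
  shows "subspace class_ring (kernel_of S) (module_vec TYPE('k) m)"
proof -
  have "subspace class_ring {v \<in> carrier_vec m. E (\<rho> x *\<^sub>v v) = 0\<^sub>v d} (module_vec TYPE('k) m)" if "x \<in> S" for x
    using subspace_kernel[OF linear_at] that assms by blast
  then show ?thesis
    by (auto simp: subspace_vec_iff kernel_of_def)
qed

lemma kernel_of_stable:
  assumes "S \<subseteq> carrier G" "n \<in> N" "v \<in> kernel_of S"
  shows "\<rho> n *\<^sub>v v \<in> kernel_of S"
proof -
  have v: "v \<in> carrier_vec m" using assms by (simp add: kernel_of_def)
  have "E (\<rho> x *\<^sub>v (\<rho> n *\<^sub>v v)) = 0\<^sub>v d" if x: "x \<in> S" for x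
  proof -
    have xG: "x \<in> carrier G" using x assms(1) by blast
    have "E (\<rho> x *\<^sub>v v) = 0\<^sub>v d" using assms(3) x by (simp add: kernel_of_def)
    then have "E (\<rho> x *\<^sub>v (\<rho> n *\<^sub>v v)) = \<sigma> (x \<otimes> n \<otimes> inv x) *\<^sub>v 0\<^sub>v d"
      using E_conj[OF xG assms(2) v] by simp
    also have "\<dots> = 0\<^sub>v d"
      by (rule linear_vec_zero[OF representation_linear[OF N_group \<sigma>_rep]])
         (use conj_in(1)[OF xG assms(2)] in simp)
    finally show ?thesis .
  qed
  then show ?thesis
    using \<rho>_vec(1) v assms(2) by (auto simp: kernel_of_def)
qed

text \<open>Conjugation by \<open>x\<close> maps \<open>N\<close> onto itself, so the image of an
  \<open>N\<close>-stable space under the translated map is stable under \<open>\<sigma>\<close>,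
  and irreducibility of \<open>\<sigma>\<close> applies.\<close>

lemma image_kernel_of:
  assumes S: "S \<subseteq> carrier G" and x: "x \<in> carrier G"
  shows "(\<lambda>v. E (\<rho> x *\<^sub>v v)) ` kernel_of S = {0\<^sub>v d} \<or> (\<lambda>v. E (\<rho> x *\<^sub>v v)) ` kernel_of S = carrier_vec d"
proof (rule irreducible_representationD(2)[OF \<sigma> subspace_image[OF linear_at[OF x] kernel_of_subspace[OF S]]])
  fix n w assume n: "n \<in> carrier (G\<lparr>carrier := N\<rparr>)" and w: "w \<in> (\<lambda>v. E (\<rho> x *\<^sub>v v)) ` kernel_of S"
  obtain v where v: "v \<in> kernel_of S" "w = E (\<rho> x *\<^sub>v v)" using w by blast
  have nN: "n \<in> N" using n by simp
  have c: "inv x \<otimes> n \<otimes> x \<in> N" by (rule conj_in(2)[OF x nN])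
  have nG: "n \<in> carrier G" using nN by simp
  have xx: "x \<otimes> (inv x \<otimes> n \<otimes> x) \<otimes> inv x = n"
    using x nG by (simp add: m_assoc) (simp add: m_assoc[symmetric])
  have "\<sigma> n *\<^sub>v w = E (\<rho> x *\<^sub>v (\<rho> (inv x \<otimes> n \<otimes> x) *\<^sub>v v))"
    using E_conj[OF x c, of v] v by (simp add: xx kernel_of_def)
  then show "\<sigma> n *\<^sub>v w \<in> (\<lambda>v. E (\<rho> x *\<^sub>v v)) ` kernel_of S"
    using kernel_of_stable[OF S c v(1)] by blast
qed

text \<open>Adding one element to \<open>S\<close> either leaves the kernel unchanged or, by
  rank-nullity, lowers its dimension by exactly \<open>d\<close>; \<open>c\<close> counts the
  drops.\<close>

lemma kernel_of_dim:
  assumes "finite S" "S \<subseteq> carrier G"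
  shows "\<exists>b c. has_dim (kernel_of S) m b \<and> b + d * c = m"
  using assms
proof (induction S rule: finite_induct)
  case empty
  have "has_dim (kernel_of {}) m m"
    using has_dim_carrier_vec by (simp add: kernel_of_def)
  then show ?case by (intro exI[of _ m] exI[of _ 0]) simp
next
  case (insert x S)
  then have x: "x \<in> carrier G" and S: "S \<subseteq> carrier G" by auto
  let ?f = "\<lambda>v. E (\<rho> x *\<^sub>v v)"
  obtain b c where bc: "has_dim (kernel_of S) m b" "b + d * c = m"
    using insert by auto
  have eq: "kernel_of (insert x S) = {v \<in> kernel_of S. ?f v = 0\<^sub>v d}"
    by (auto simp: kernel_of_def)
  from image_kernel_of[OF S x] show ?case
  proof
    assume "?f ` kernel_of S = {0\<^sub>v d}"
    then have "kernel_of (insert x S) = kernel_of S"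
      unfolding eq by blast
    with bc show ?thesis by auto
  next
    assume surj: "?f ` kernel_of S = carrier_vec d"
    obtain b' where b': "has_dim {v \<in> kernel_of S. ?f v = 0\<^sub>v d} m b'"
      using subspace_has_dim[OF kernel_of_subspace[of "insert x S"]] insert.prems unfolding eq by blast
    have "b = b' + d"
      by (rule rank_nullity[OF kernel_of_subspace[OF S] bc(1) linear_at[OF x] surj b'])
    then have "b' + d * Suc c = m" using bc(2) by simp
    with b' show ?thesis unfolding eq by blast
  qed
qed

text \<open>With all of \<open>G\<close> as index set the kernel is stable under \<open>G\<close>,
  not just under \<open>N\<close>, because applying \<open>\<rho> g\<close> merely permutes the
  translates. Irreducibility of \<open>\<rho>\<close> then applies, and the translate by 1 excludes
  the whole space.\<close>

lemma kernel_of_all: "kernel_of (carrier G) = {0\<^sub>v m}"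
proof -
  have "kernel_of (carrier G) = {0\<^sub>v m} \<or> kernel_of (carrier G) = carrier_vec m"
  proof (rule irreducible_representationD(2)[OF \<rho> kernel_of_subspace[OF order_refl]])
    fix g v assume g: "g \<in> carrier G" and v: "v \<in> kernel_of (carrier G)"
    then have vm: "v \<in> carrier_vec m" by (simp add: kernel_of_def)
    have "E (\<rho> x *\<^sub>v (\<rho> g *\<^sub>v v)) = 0\<^sub>v d" if "x \<in> carrier G" for x
      using that g v vm by (simp add: \<rho>_vec(3)[symmetric] kernel_of_def)
    then show "\<rho> g *\<^sub>v v \<in> kernel_of (carrier G)"
      using \<rho>_vec(1)[OF vm g] by (simp add: kernel_of_def)
  qed
  moreover have "kernel_of (carrier G) \<noteq> carrier_vec m"
  proof
    assume eq: "kernel_of (carrier G) = carrier_vec m"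
    obtain v where v: "v \<in> carrier_vec m" "E v \<noteq> 0\<^sub>v d" using nonzero by blast
    have "v \<in> kernel_of (carrier G)" using v(1) eq by simp
    then have "E (\<rho> \<one> *\<^sub>v v) = 0\<^sub>v d" by (auto simp: kernel_of_def)
    with v \<rho>_vec(2)[OF v(1)] show False by simp
  qed
  ultimately show ?thesis by blast
qed

lemma degree_dvd: "d dvd m"
proof -
  obtain b c where bc: "has_dim (kernel_of (carrier G)) m b" "b + d * c = m"
    using kernel_of_dim[OF fin order_refl] by blast
  have "b = 0"
    using has_dim_unique[OF bc(1)] has_dim_0_iff[of "{0\<^sub>v m}" m] by (simp add: kernel_of_all)
  with bc(2) show ?thesis by auto
qed

text \<open>\<open>E\<close> is onto by irreducibility of \<open>\<sigma>\<close>, so equal degrees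
  make it bijective. It is then an isomorphism of \<open>N\<close>-modules, and stable subspaces
  correspond to those of \<open>\<sigma>\<close>.\<close>

lemma restrict_irreducible:
  assumes dm: "d = m"
  shows "irreducible_representation (G\<lparr>carrier := N\<rparr>) m \<rho>"
  unfolding irreducible_representation_def
proof (intro conjI allI impI)
  show "representation (G\<lparr>carrier := N\<rparr>) m \<rho>"
    by (rule representation_restrict[OF is_group subgroup_axioms \<rho>_rep])
  have surj: "E ` carrier_vec m = carrier_vec d"
    using intertwiner_image[OF N_group representation_restrict[OF is_group subgroup_axioms \<rho>_rep] \<sigma> E _ subspace_carrier_vec]
      equivariant \<rho>_vec(1) nonzero by auto
  obtain b where b: "has_dim {v \<in> carrier_vec m. E v = 0\<^sub>v d} m b"
    using subspace_has_dim[OF subspace_kernel[OF E]] by blast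
  have "m = b + d"
    by (rule rank_nullity[OF subspace_carrier_vec has_dim_carrier_vec E surj b])
  then have "{v \<in> carrier_vec m. E v = 0\<^sub>v d} = {0\<^sub>v m}"
    using b dm by (simp add: has_dim_0_iff)
  then have inj: "inj_on E (carrier_vec m)"
    by (intro linear_vec_inj_onI[OF E]) blast
  fix W assume "subspace class_ring W (module_vec TYPE('k) m) \<and>
    (\<forall>g\<in>carrier (G\<lparr>carrier := N\<rparr>). \<forall>w\<in>W. \<rho> g *\<^sub>v w \<in> W)"
  then have W: "subspace class_ring W (module_vec TYPE('k) m)"
    "\<And>g w. g \<in> N \<Longrightarrow> w \<in> W \<Longrightarrow> \<rho> g *\<^sub>v w \<in> W" by auto
  have Wm: "W \<subseteq> carrier_vec m" using W(1) by (simp add: subspace_vec_iff)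
  have "E ` W = {0\<^sub>v d} \<or> E ` W = carrier_vec d"
    by (rule intertwiner_image[OF N_group representation_restrict[OF is_group subgroup_axioms \<rho>_rep] \<sigma> E _ W(1)])
       (use W(2) Wm equivariant in auto)
  moreover have "E ` {0\<^sub>v m} = {0\<^sub>v d}" using linear_vec_zero[OF E] by simp
  ultimately have "E ` W = E ` {0\<^sub>v m} \<or> E ` W = E ` carrier_vec m"
    using surj by metis
  then show "W = {0\<^sub>v m} \<or> W = carrier_vec m"
    using inj_on_image_eq_iff[OF inj Wm] by (metis empty_subsetI insert_subset order_refl zero_carrier_vec)
qed

end

subsection \<open>Tensor products\<close>

text \<open>The \<open>r\<close> by \<open>q\<close> matrices model the tensor product of two
  coordinate spaces. Row-major flattening converts them to vectors, on which a
  \<open>representation\<close> has to act.\<close>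

definition vec_of_mat :: "'k mat \<Rightarrow> 'k vec" where
  "vec_of_mat A = vec (dim_row A * dim_col A) (\<lambda>k. A $$ (k div dim_col A, k mod dim_col A))"

definition mat_of_vec :: "nat \<Rightarrow> nat \<Rightarrow> 'k vec \<Rightarrow> 'k mat" where
  "mat_of_vec r q v = mat r q (\<lambda>(i, j). v $ (i * q + j))"

lemma mat_index_less: "i < r \<Longrightarrow> j < q \<Longrightarrow> i * q + j < r * (q::nat)"
proof -
  assume "i < r" "j < q"
  then have "Suc i * q \<le> r * q" by (intro mult_le_mono1) simp
  with \<open>j < q\<close> show ?thesis by simp
qed

lemma mat_index_div_mod:
  fixes k r q :: nat
  assumes "k < r * q" shows "k div q < r" "k mod q < q"
proof -
  have "0 < q" using assms by (cases q) auto
  then show "k div q < r" "k mod q < q"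
    using assms by (auto simp: less_mult_imp_div_less)
qed

lemma mat_of_vec_carrier [simp]: "mat_of_vec r q v \<in> carrier_mat r q"
  by (simp add: mat_of_vec_def)

lemma mat_of_vec_dim [simp]: "dim_row (mat_of_vec r q v) = r" "dim_col (mat_of_vec r q v) = q"
  by (simp_all add: mat_of_vec_def)

lemma vec_of_mat_carrier: "A \<in> carrier_mat r q \<Longrightarrow> vec_of_mat A \<in> carrier_vec (r * q)"
  by (auto simp: vec_of_mat_def)

lemma mat_of_vec_of_mat:
  assumes "A \<in> carrier_mat r q"
  shows "mat_of_vec r q (vec_of_mat A) = A"
proof (rule eq_matI)
  fix i j assume "i < dim_row A" "j < dim_col A"
  then show "mat_of_vec r q (vec_of_mat A) $$ (i, j) = A $$ (i, j)"
    using assms mat_index_less[of i r j q] by (simp add: mat_of_vec_def vec_of_mat_def)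
qed (use assms in auto)

lemma vec_of_mat_of_vec:
  assumes "v \<in> carrier_vec (r * q)"
  shows "vec_of_mat (mat_of_vec r q v) = v"
proof (rule eq_vecI)
  fix k assume "k < dim_vec v"
  then show "vec_of_mat (mat_of_vec r q v) $ k = v $ k"
    using assms mat_index_div_mod[of k r q] by (simp add: mat_of_vec_def vec_of_mat_def)
qed (use assms in \<open>auto simp: mat_of_vec_def vec_of_mat_def\<close>)

lemma bij_mat_of_vec: "bij_betw (mat_of_vec r q) (carrier_vec (r * q)) (carrier_mat r q)"
  by (rule bij_betwI[where g = vec_of_mat])
     (auto simp: vec_of_mat_carrier mat_of_vec_of_mat vec_of_mat_of_vec)

lemma mat_of_vec_add:
  "v \<in> carrier_vec (r * q) \<Longrightarrow> w \<in> carrier_vec (r * q) \<Longrightarrow>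
    mat_of_vec r q (v + w) = mat_of_vec r q v + mat_of_vec r q (w :: 'k::field vec)"
  by (intro eq_matI) (auto simp: mat_of_vec_def mat_index_less)

lemma mat_of_vec_smult:
  "v \<in> carrier_vec (r * q) \<Longrightarrow> mat_of_vec r q (c \<cdot>\<^sub>v v) = c \<cdot>\<^sub>m mat_of_vec r q (v :: 'k::field vec)"
  by (intro eq_matI) (auto simp: mat_of_vec_def mat_index_less)

lemma vec_of_mat_add:
  "A \<in> carrier_mat r q \<Longrightarrow> B \<in> carrier_mat r q \<Longrightarrow>
    vec_of_mat (A + B) = vec_of_mat A + vec_of_mat (B :: 'k::field mat)"
  using mat_index_div_mod[of _ r q] by (intro eq_vecI) (auto simp: vec_of_mat_def)

lemma vec_of_mat_smult:
  "A \<in> carrier_mat r q \<Longrightarrow> vec_of_mat (c \<cdot>\<^sub>m A) = c \<cdot>\<^sub>v vec_of_mat (A :: 'k::field mat)"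
  using mat_index_div_mod[of _ r q] by (intro eq_vecI) (auto simp: vec_of_mat_def)

text \<open>Both the tensor product and the induced module are built through this lemma, as actions
  on matrices that are flattened afterwards.\<close>

lemma representation_on_matrices:
  fixes T :: "'a \<Rightarrow> 'k::alg_closed_field mat \<Rightarrow> 'k mat"
  assumes G: "group G" and pos: "0 < r" "0 < q"
    and T: "\<And>g A. g \<in> carrier G \<Longrightarrow> A \<in> carrier_mat r q \<Longrightarrow> T g A \<in> carrier_mat r q"
    and add: "\<And>g A B. g \<in> carrier G \<Longrightarrow> A \<in> carrier_mat r q \<Longrightarrow> B \<in> carrier_mat r q \<Longrightarrow> T g (A + B) = T g A + T g B"
    and smult: "\<And>g c A. g \<in> carrier G \<Longrightarrow> A \<in> carrier_mat r q \<Longrightarrow> T g (c \<cdot>\<^sub>m A) = c \<cdot>\<^sub>m T g A"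
    and one: "\<And>A. A \<in> carrier_mat r q \<Longrightarrow> T \<one>\<^bsub>G\<^esub> A = A"
    and mult: "\<And>g h A. g \<in> carrier G \<Longrightarrow> h \<in> carrier G \<Longrightarrow> A \<in> carrier_mat r q \<Longrightarrow>
      T (g \<otimes>\<^bsub>G\<^esub> h) A = T g (T h A)"
  obtains \<rho> where "representation G (r * q) \<rho>"
    "\<And>g v. g \<in> carrier G \<Longrightarrow> v \<in> carrier_vec (r * q) \<Longrightarrow>
      mat_of_vec r q (\<rho> g *\<^sub>v v) = T g (mat_of_vec r q v)"
proof (rule representation_of_action[OF G _ bij_mat_of_vec, of r q T])
  show "0 < r * q" using pos by simp
  have inv: "inv_into (carrier_vec (r * q)) (mat_of_vec r q) A = vec_of_mat A" if "A \<in> carrier_mat r q" for A :: "'k mat"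
    using bij_mat_of_vec that
    by (intro inv_into_f_eq) (auto simp: bij_betw_def vec_of_mat_carrier mat_of_vec_of_mat)
  show "linear_vec (r * q) (r * q) (\<lambda>v. inv_into (carrier_vec (r * q)) (mat_of_vec r q) (T g (mat_of_vec r q v)))"
    if g: "g \<in> carrier G" for g
  proof -
    have Tc: "T g (mat_of_vec r q v) \<in> carrier_mat r q" for v
      by (rule T[OF g mat_of_vec_carrier])
    show ?thesis
      unfolding inv[OF Tc] using Tc
      by (intro linear_vecI)
         (auto simp: vec_of_mat_carrier mat_of_vec_add mat_of_vec_smult add[OF g] smult[OF g]
            vec_of_mat_add[OF Tc Tc] vec_of_mat_smult[OF Tc])
  qed
qed (use T one mult that in blast)+

section \<open>Pure tensors and tensor products of representations\<close>

definition outer :: "'k::field vec \<Rightarrow> 'k vec \<Rightarrow> 'k mat" where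
  "outer v y = mat (dim_vec v) (dim_vec y) (\<lambda>(i, j). v $ i * y $ j)"

lemma outer_carrier: "v \<in> carrier_vec r \<Longrightarrow> y \<in> carrier_vec q \<Longrightarrow> outer v y \<in> carrier_mat r q"
  by (auto simp: outer_def)

text \<open>With \<open>outer v y\<close> as the pure tensor of \<open>v\<close> and
  \<open>y\<close>, this shows that multiplying by \<open>A\<close> on the left and by the transpose
  of \<open>B\<close> on the right is the tensor product of \<open>A\<close> and
  \<open>B\<close>.\<close>

lemma mult_outer:
  assumes "A \<in> carrier_mat r r" "v \<in> carrier_vec r" "B \<in> carrier_mat q q" "y \<in> carrier_vec q"
  shows "A * outer v y * B\<^sup>T = outer (A *\<^sub>v v) (B *\<^sub>v y)"
proof -
  have 1: "A * outer v y = outer (A *\<^sub>v v) y"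
    using assms by (intro eq_matI) (auto simp: outer_def scalar_prod_def sum_distrib_right mult.assoc)
  have 2: "outer w y * B\<^sup>T = outer w (B *\<^sub>v y)" if "w \<in> carrier_vec r" for w
    using that assms
    by (intro eq_matI) (auto simp: outer_def scalar_prod_def sum_distrib_left mult_ac intro!: sum.cong)
  show ?thesis
    unfolding 1 by (rule 2[OF mult_mat_vec_carrier[OF assms(1,2)]])
qed

lemma outer_add:
  "v \<in> carrier_vec r \<Longrightarrow> y \<in> carrier_vec q \<Longrightarrow> z \<in> carrier_vec q \<Longrightarrow> outer v (y + z) = outer v y + outer v z"
  by (intro eq_matI) (auto simp: outer_def distrib_left)

lemma outer_smult:
  "v \<in> carrier_vec r \<Longrightarrow> y \<in> carrier_vec q \<Longrightarrow> outer v (c \<cdot>\<^sub>v y) = c \<cdot>\<^sub>m outer v y"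
  by (intro eq_matI) (auto simp: outer_def)

lemma outer_zero: "v \<in> carrier_vec r \<Longrightarrow> vec_of_mat (outer v (0\<^sub>v q)) = 0\<^sub>v (r * q)"
  using mat_index_div_mod[of _ r q] by (intro eq_vecI) (auto simp: outer_def vec_of_mat_def)

text \<open>Flattened matrix units are pure tensors, so a subspace containing all pure tensors is
  the whole space.\<close>

lemma vec_of_mat_outer_unit:
  assumes "k < r * q"
  shows "vec_of_mat (outer (unit_vec r (k div q)) (unit_vec q (k mod q))) = (unit_vec (r * q) k :: 'k::field vec)"
proof (rule eq_vecI)
  fix l assume "l < dim_vec (unit_vec (r * q) k :: 'k vec)"
  then have l: "l < r * q" by simp
  have "l = k" if "l div q = k div q" "l mod q = k mod q"
    using that by (metis div_mult_mod_eq)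
  then show "vec_of_mat (outer (unit_vec r (k div q)) (unit_vec q (k mod q))) $ l = (unit_vec (r * q) k :: 'k vec) $ l"
    using l mat_index_div_mod[OF l] mat_index_div_mod[OF assms] assms
    by (auto simp: vec_of_mat_def outer_def)
qed (simp add: vec_of_mat_def outer_def)

lemma linear_vec_mat_of_vec_col:
  assumes "j < q"
  shows "linear_vec (r * q) r (\<lambda>v. col (mat_of_vec r q v) j)"
  using assms by (intro linear_vecI) (auto simp: mat_of_vec_add mat_of_vec_smult intro!: eq_vecI)

text \<open>Transposition reverses products, and so does multiplication on the right; together they
  make the second factor act from the left.\<close>

lemma tensor_representation:
  fixes \<chi> \<phi> :: "'a \<Rightarrow> 'k::alg_closed_field mat"
  assumes G: "group G" and \<chi>: "representation G r \<chi>" and \<phi>: "representation G q \<phi>"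
  obtains \<rho> where "representation G (r * q) \<rho>"
    "\<And>g v. g \<in> carrier G \<Longrightarrow> v \<in> carrier_vec (r * q) \<Longrightarrow>
      mat_of_vec r q (\<rho> g *\<^sub>v v) = \<chi> g * mat_of_vec r q v * (\<phi> g)\<^sup>T"
proof -
  have c: "\<chi> g \<in> carrier_mat r r" "\<phi> g \<in> carrier_mat q q" if "g \<in> carrier G" for g
    using that \<chi> \<phi> by (auto simp: representation_iff[OF G])
  show thesis
  proof (rule representation_on_matrices[OF G, of r q "\<lambda>g A. \<chi> g * A * (\<phi> g)\<^sup>T"])
    show "0 < r" "0 < q" using \<chi> \<phi> by (auto simp: representation_def)
    fix A :: "'k mat" assume A: "A \<in> carrier_mat r q"
    show "\<chi> \<one>\<^bsub>G\<^esub> * A * (\<phi> \<one>\<^bsub>G\<^esub>)\<^sup>T = A"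
      using A \<chi> \<phi> by (simp add: representation_iff[OF G] transpose_one)
    fix g assume g: "g \<in> carrier G"
    have ct: "(\<phi> g)\<^sup>T \<in> carrier_mat q q" using c[OF g] by simp
    show "\<chi> g * A * (\<phi> g)\<^sup>T \<in> carrier_mat r q"
      using c[OF g] A ct by (intro mult_carrier_mat[of _ r q] mult_carrier_mat[of _ r r])
    show "\<chi> g * (a \<cdot>\<^sub>m A) * (\<phi> g)\<^sup>T = a \<cdot>\<^sub>m (\<chi> g * A * (\<phi> g)\<^sup>T)" for a
      using mult_smult_distrib[OF c(1)[OF g] A, of a]
        mult_smult_assoc_mat[OF mult_carrier_mat[OF c(1)[OF g] A] ct, of a] by (simp only:)
    show "\<chi> g * (A + B) * (\<phi> g)\<^sup>T = \<chi> g * A * (\<phi> g)\<^sup>T + \<chi> g * B * (\<phi> g)\<^sup>T"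
      if "B \<in> carrier_mat r q" for B
      using mult_add_distrib_mat[OF c(1)[OF g] A that]
        add_mult_distrib_mat[OF mult_carrier_mat[OF c(1)[OF g] A] mult_carrier_mat[OF c(1)[OF g] that] ct]
      by simp
    fix h assume h: "h \<in> carrier G"
    have ht: "(\<phi> h)\<^sup>T \<in> carrier_mat q q" using c[OF h] by simp
    have "\<chi> (g \<otimes>\<^bsub>G\<^esub> h) * A * (\<phi> (g \<otimes>\<^bsub>G\<^esub> h))\<^sup>T = (\<chi> g * \<chi> h) * A * ((\<phi> h)\<^sup>T * (\<phi> g)\<^sup>T)"
      using g h \<chi> \<phi> c by (simp add: representation_iff[OF G] transpose_mult[of _ q q _ q])
    also have "\<dots> = \<chi> g * (\<chi> h * A * (\<phi> h)\<^sup>T) * (\<phi> g)\<^sup>T"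
    proof -
      note hA = mult_carrier_mat[OF c(1)[OF h] A]
      have "(\<chi> g * \<chi> h) * A = \<chi> g * (\<chi> h * A)"
        by (rule assoc_mult_mat[OF c(1)[OF g] c(1)[OF h] A])
      moreover have "\<chi> g * (\<chi> h * A) * ((\<phi> h)\<^sup>T * (\<phi> g)\<^sup>T) = \<chi> g * (\<chi> h * A) * (\<phi> h)\<^sup>T * (\<phi> g)\<^sup>T"
        by (rule assoc_mult_mat[OF mult_carrier_mat[OF c(1)[OF g] hA] ht ct, symmetric])
      moreover have "\<chi> g * (\<chi> h * A) * (\<phi> h)\<^sup>T = \<chi> g * (\<chi> h * A * (\<phi> h)\<^sup>T)"
        by (rule assoc_mult_mat[OF c(1)[OF g] hA ht])
      ultimately show ?thesis by simp
    qed
    finally show "\<chi> (g \<otimes>\<^bsub>G\<^esub> h) * A * (\<phi> (g \<otimes>\<^bsub>G\<^esub> h))\<^sup>T = \<chi> g * (\<chi> h * A * (\<phi> h)\<^sup>T) * (\<phi> g)\<^sup>T" .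
  qed (rule that)
qed

text \<open>
  The key point: an irreducible \<open>N\<close>-submodule of \<open>\<chi> \<otimes> \<phi>\<close> has the form \<open>\<chi> \<otimes> y\<close>, because by Schur's lemma
  its coordinate projections to \<open>\<chi>\<close> are proportional.
\<close>

lemma tensor_pure_submodule:
  fixes \<chi> \<rho> :: "'a \<Rightarrow> 'k::alg_closed_field mat"
  assumes N: "group N" and \<chi>: "irreducible_representation N r \<chi>" and \<rho>: "representation N (r * q) \<rho>"
    and action: "\<And>g v. g \<in> carrier N \<Longrightarrow> v \<in> carrier_vec (r * q) \<Longrightarrow>
      mat_of_vec r q (\<rho> g *\<^sub>v v) = \<chi> g * mat_of_vec r q v"
    and U: "subspace class_ring U (module_vec TYPE('k) (r * q))" "U \<noteq> {0\<^sub>v (r * q)}"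
    and stable: "\<And>g u. g \<in> carrier N \<Longrightarrow> u \<in> U \<Longrightarrow> \<rho> g *\<^sub>v u \<in> U"
  obtains y where "y \<in> carrier_vec q" "y \<noteq> 0\<^sub>v q"
    "\<And>v. v \<in> carrier_vec r \<Longrightarrow> vec_of_mat (outer v y) \<in> U"
proof -
  note \<chi>_rep = irreducible_representationD(1)[OF \<chi>]
  have r: "0 < r" using \<chi>_rep by (simp add: representation_def)
  obtain m \<tau> f where \<tau>: "irreducible_representation N m \<tau>" and f: "linear_vec m (r * q) f"
      "inj_on f (carrier_vec m)" "f ` carrier_vec m \<subseteq> U"
      "\<And>g v. g \<in> carrier N \<Longrightarrow> v \<in> carrier_vec m \<Longrightarrow> f (\<tau> g *\<^sub>v v) = \<rho> g *\<^sub>v f v"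
    using irreducible_subrepresentation[OF N \<rho> U stable] by blast
  note \<tau>_rep = irreducible_representationD(1)[OF \<tau>]
  have m: "0 < m" using \<tau>_rep by (simp add: representation_def)
  have fc: "f u \<in> carrier_vec (r * q)" if "u \<in> carrier_vec m" for u
    using f(1) that by (rule linear_vec_closed)
  \<comment> \<open>\<open>N\<close> acts by left multiplication, hence on each column separately,
    so every column projection is an intertwiner from \<open>\<tau>\<close> to
    \<open>\<chi>\<close>.\<close>
  define C where "C j u = col (mat_of_vec r q (f u)) j" for j u
  have C: "linear_vec m r (C j)" if "j < q" for j
    unfolding C_def by (rule linear_vec_comp[OF f(1) linear_vec_mat_of_vec_col[OF that]])
  have C_int: "C j (\<tau> g *\<^sub>v u) = \<chi> g *\<^sub>v C j u" if "j < q" "g \<in> carrier N" "u \<in> carrier_vec m" for j g u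
  proof -
    have "\<chi> g \<in> carrier_mat r r" using \<chi>_rep that(2) by (simp add: representation_iff[OF N])
    then have "col (\<chi> g * mat_of_vec r q (f u)) j = \<chi> g *\<^sub>v col (mat_of_vec r q (f u)) j"
      by (rule col_mult2) (use that(1) in auto)
    then show ?thesis
      using f(4) action fc that by (simp add: C_def)
  qed
  have "f (unit_vec m 0) \<noteq> 0\<^sub>v (r * q)"
  proof
    assume "f (unit_vec m 0) = 0\<^sub>v (r * q)"
    then have "f (unit_vec m 0) = f (0\<^sub>v m)" using linear_vec_zero[OF f(1)] by simp
    then have "unit_vec m 0 = (0\<^sub>v m :: 'k vec)" using f(2) by (auto dest: inj_onD)
    then have "unit_vec m 0 $ 0 = (0\<^sub>v m :: 'k vec) $ 0" by simp
    with m show False by simp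
  qed
  then obtain k where k: "k < r * q" "f (unit_vec m 0) $ k \<noteq> 0"
    using fc[of "unit_vec m 0"] by (auto simp: vec_eq_iff)
  \<comment> \<open>A column that does not vanish on the image of \<open>f\<close>. By Schur's lemma
    its projection is an isomorphism, against which all other columns are measured.\<close>
  define j0 where "j0 = k mod q"
  have j0: "j0 < q" and i0: "k div q < r" using mat_index_div_mod[OF k(1)] by (simp_all add: j0_def)
  have "C j0 (unit_vec m 0) $ (k div q) \<noteq> 0"
    using k i0 j0 by (simp add: C_def mat_of_vec_def) (simp add: j0_def)
  then have "C j0 (unit_vec m 0) \<noteq> 0\<^sub>v r" using i0 by auto
  then have bij: "bij_betw (C j0) (carrier_vec m) (carrier_vec r)"
    using schur_bij[OF N \<tau> \<chi> C[OF j0] C_int[OF j0], of "unit_vec m 0"] by simp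
  define T where "T v = inv_into (carrier_vec m) (C j0) v" for v
  have T: "T v \<in> carrier_vec m" "C j0 (T v) = v" if "v \<in> carrier_vec r" for v
    using that bij by (auto simp: T_def bij_betw_def inv_into_into f_inv_into_f)
  have "linear_vec r r (\<lambda>v :: 'k vec. v)" by (simp add: linear_vec_def)
  from linear_vec_inv_into[OF C[OF j0] bij this] have T_lin: "linear_vec r m T"
    by (simp add: T_def[abs_def])
  have T_int: "T (\<chi> g *\<^sub>v v) = \<tau> g *\<^sub>v T v" if "g \<in> carrier N" "v \<in> carrier_vec r" for g v
  proof -
    have "C j0 (T (\<chi> g *\<^sub>v v)) = C j0 (\<tau> g *\<^sub>v T v)"
      using that T representation_vec(1)[OF N \<chi>_rep] C_int[OF j0] by simp
    then show ?thesis
      using inj_onD[OF bij_betw_imp_inj_on[OF bij]] that T representation_vec(1)[OF N \<chi>_rep]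
        representation_vec(1)[OF N \<tau>_rep]
      by blast
  qed
  have "\<exists>c. \<forall>v\<in>carrier_vec r. C j (T v) = c \<cdot>\<^sub>v v" if j: "j < q" for j
  proof -
    obtain c where "\<And>v. v \<in> carrier_vec r \<Longrightarrow> C j (T v) = c \<cdot>\<^sub>v v"
    proof (rule schur_scalar[OF N \<chi> linear_vec_comp[OF T_lin C[OF j]]])
      show "C j (T (\<chi> g *\<^sub>v v)) = \<chi> g *\<^sub>v C j (T v)" if "g \<in> carrier N" "v \<in> carrier_vec r" for g v
        using that T T_int C_int[OF j] by simp
    qed blast
    then show ?thesis by blast
  qed
  then obtain c where c: "\<And>j v. j < q \<Longrightarrow> v \<in> carrier_vec r \<Longrightarrow> C j (T v) = c j \<cdot>\<^sub>v v"
    by metis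
  \<comment> \<open>Column \<open>j\<close> of the matrix of \<open>f (T v)\<close> is
    \<open>c j\<close> times \<open>v\<close>, so this matrix is the pure tensor of \<open>v\<close>
    with the vector of the factors \<open>c j\<close>.\<close>
  define y where "y = vec q c"
  show thesis
  proof (rule that)
    show "y \<in> carrier_vec q" by (simp add: y_def)
    \<comment> \<open>Column \<open>j0\<close> is compared with itself, so its factor is 1; this is
      why \<open>y\<close> is nonzero.\<close>
    have "(c j0 \<cdot>\<^sub>v unit_vec r 0) $ 0 = (unit_vec r 0 :: 'k vec) $ 0"
      using c[OF j0, of "unit_vec r 0"] T(2)[of "unit_vec r 0"] by simp
    then have "c j0 = 1" using r by simp
    then show "y \<noteq> 0\<^sub>v q" using j0 unfolding y_def by (metis index_vec index_zero_vec(1) zero_neq_one)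
    fix v :: "'k vec" assume v: "v \<in> carrier_vec r"
    have "mat_of_vec r q (f (T v)) = outer v y"
    proof (rule eq_matI)
      fix i j assume "i < dim_row (outer v y)" "j < dim_col (outer v y)"
      then have ij: "i < r" "j < q" using v by (auto simp: outer_def y_def)
      have "mat_of_vec r q (f (T v)) $$ (i, j) = C j (T v) $ i"
        using ij by (simp add: C_def mat_of_vec_def)
      also have "\<dots> = outer v y $$ (i, j)"
        using ij v by (simp add: c outer_def y_def)
      finally show "mat_of_vec r q (f (T v)) $$ (i, j) = outer v y $$ (i, j)" .
    qed (use v in \<open>auto simp: outer_def y_def mat_of_vec_def\<close>)
    then have "vec_of_mat (outer v y) = f (T v)"
      using vec_of_mat_of_vec[OF fc[OF T(1)[OF v]]] by simp
    then show "vec_of_mat (outer v y) \<in> U"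
      using f(3) T(1)[OF v] by auto
  qed
qed

text \<open>For a nonzero submodule \<open>U\<close>, the vectors \<open>y\<close> such that all
  pure tensors of \<open>\<chi>\<close> with \<open>y\<close> lie in \<open>U\<close> form a
  submodule \<open>Y\<close> of \<open>\<phi>\<close>. Restriction to \<open>N\<close>, where
  \<open>\<phi>\<close> is trivial, shows through \<open>tensor_pure_submodule\<close> that
  \<open>Y\<close> is nonzero. So \<open>Y\<close> is everything, and \<open>U\<close> contains all
  pure tensors.\<close>

lemma tensor_irreducible:
  fixes \<chi> \<phi> :: "'a \<Rightarrow> 'k::alg_closed_field mat"
  assumes G: "group G" and N: "subgroup N G"
    and \<chi>: "representation G r \<chi>" "irreducible_representation (G\<lparr>carrier := N\<rparr>) r \<chi>"
    and \<phi>: "irreducible_representation G q \<phi>" "\<And>n. n \<in> N \<Longrightarrow> \<phi> n = 1\<^sub>m q"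
  obtains \<rho> :: "'a \<Rightarrow> 'k mat" where "irreducible_representation G (r * q) \<rho>"
proof -
  interpret group G by fact
  note \<phi>_rep = irreducible_representationD(1)[OF \<phi>(1)]
  note N_group = group.subgroup_imp_group[OF G N]
  have c: "\<chi> g \<in> carrier_mat r r" "\<phi> g \<in> carrier_mat q q" if "g \<in> carrier G" for g
    using that \<chi>(1) \<phi>_rep by (auto simp: representation_iff[OF G])
  obtain \<rho> where \<rho>: "representation G (r * q) \<rho>"
    "\<And>g v. g \<in> carrier G \<Longrightarrow> v \<in> carrier_vec (r * q) \<Longrightarrow>
      mat_of_vec r q (\<rho> g *\<^sub>v v) = \<chi> g * mat_of_vec r q v * (\<phi> g)\<^sup>T"
    using tensor_representation[OF G \<chi>(1) \<phi>_rep] by blast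
  have \<rho>_outer: "\<rho> g *\<^sub>v vec_of_mat (outer v y) = vec_of_mat (outer (\<chi> g *\<^sub>v v) (\<phi> g *\<^sub>v y))"
    if "g \<in> carrier G" "v \<in> carrier_vec r" "y \<in> carrier_vec q" for g v y
  proof -
    note o = outer_carrier[OF that(2,3)]
    have "mat_of_vec r q (\<rho> g *\<^sub>v vec_of_mat (outer v y)) = outer (\<chi> g *\<^sub>v v) (\<phi> g *\<^sub>v y)"
      using \<rho>(2)[OF that(1) vec_of_mat_carrier[OF o]] mult_outer[OF c(1)[OF that(1)] that(2) c(2)[OF that(1)] that(3)]
      by (simp add: mat_of_vec_of_mat[OF o])
    then show ?thesis
      using vec_of_mat_of_vec[OF representation_vec(1)[OF G \<rho>(1) vec_of_mat_carrier[OF o] that(1)]] by simp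
  qed
  have "irreducible_representation G (r * q) \<rho>"
    unfolding irreducible_representation_def
  proof (intro conjI allI impI \<rho>(1))
    fix U assume "subspace class_ring U (module_vec TYPE('k) (r * q)) \<and> (\<forall>g\<in>carrier G. \<forall>w\<in>U. \<rho> g *\<^sub>v w \<in> U)"
    then have U: "subspace class_ring U (module_vec TYPE('k) (r * q))"
      and stable: "\<And>g w. g \<in> carrier G \<Longrightarrow> w \<in> U \<Longrightarrow> \<rho> g *\<^sub>v w \<in> U" by auto
    show "U = {0\<^sub>v (r * q)} \<or> U = carrier_vec (r * q)"
    proof (cases "U = {0\<^sub>v (r * q)}")
      case False
      obtain y0 where y0: "y0 \<in> carrier_vec q" "y0 \<noteq> 0\<^sub>v q"
        "\<And>v. v \<in> carrier_vec r \<Longrightarrow> vec_of_mat (outer v y0) \<in> U"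
      proof (rule tensor_pure_submodule[OF N_group \<chi>(2) representation_restrict[OF G N \<rho>(1)] _ U False])
        fix n and v :: "'k vec" assume n: "n \<in> carrier (G\<lparr>carrier := N\<rparr>)" and v: "v \<in> carrier_vec (r * q)"
        then have nN: "n \<in> N" "n \<in> carrier G" using subgroup.subset[OF N] by auto
        then show "mat_of_vec r q (\<rho> n *\<^sub>v v) = \<chi> n * mat_of_vec r q v"
          using \<rho>(2)[of n v] v \<phi>(2) right_mult_one_mat[OF mult_carrier_mat[OF c(1)[OF nN(2)] mat_of_vec_carrier]]
          by (simp add: transpose_one)
      next
        fix n u assume "n \<in> carrier (G\<lparr>carrier := N\<rparr>)" "u \<in> U"
        then show "\<rho> n *\<^sub>v u \<in> U" using stable subgroup.subset[OF N] by auto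
      qed blast
      define Y where "Y = {y \<in> carrier_vec q. \<forall>v\<in>carrier_vec r. vec_of_mat (outer v y) \<in> U}"
      have "Y = {0\<^sub>v q} \<or> Y = carrier_vec q"
      proof (rule irreducible_representationD(2)[OF \<phi>(1)])
        show "subspace class_ring Y (module_vec TYPE('k) q)"
          using U unfolding subspace_vec_iff Y_def
          by (auto simp: outer_zero outer_add outer_smult vec_of_mat_smult[OF outer_carrier]
              vec_of_mat_add[OF outer_carrier outer_carrier])
        fix g y assume g: "g \<in> carrier G" and "y \<in> Y"
        then have y: "y \<in> carrier_vec q" "\<And>v. v \<in> carrier_vec r \<Longrightarrow> vec_of_mat (outer v y) \<in> U"
          by (auto simp: Y_def)
        have "vec_of_mat (outer v (\<phi> g *\<^sub>v y)) \<in> U" if v: "v \<in> carrier_vec r" for v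
        proof -
          \<comment> \<open>Chosen so that \<open>\<rho> g\<close> maps the pure tensor of
            \<open>w\<close> and \<open>y\<close> to that of \<open>v\<close> and
            \<open>\<phi> g *\<^sub>v y\<close>.\<close>
          define w where "w = \<chi> (inv\<^bsub>G\<^esub> g) *\<^sub>v v"
          have w: "w \<in> carrier_vec r" "\<chi> g *\<^sub>v w = v"
            using g v representation_vec[OF G \<chi>(1) v] unfolding w_def
            by (auto simp: representation_vec(3)[OF G \<chi>(1) v, symmetric])
          show ?thesis
            using stable[OF g y(2)[OF w(1)]] \<rho>_outer[OF g w(1) y(1)] w(2) by simp
        qed
        then show "\<phi> g *\<^sub>v y \<in> Y"
          using representation_vec(1)[OF G \<phi>_rep y(1) g] by (simp add: Y_def)
      qed
      moreover have "y0 \<in> Y" using y0 by (simp add: Y_def)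
      ultimately have Y: "Y = carrier_vec q" using y0(2) by auto
      have "unit_vec (r * q) k \<in> U" if "k < r * q" for k
      proof -
        have "unit_vec q (k mod q) \<in> Y" by (simp add: Y)
        then have "vec_of_mat (outer (unit_vec r (k div q)) (unit_vec q (k mod q))) \<in> U"
          by (simp add: Y_def)
        then show ?thesis by (simp add: vec_of_mat_outer_unit[OF that])
      qed
      then show ?thesis using subspace_unit_vecs[OF U] by blast
    qed simp
  qed
  then show thesis by (rule that)
qed

subsection \<open>Induction from a subgroup\<close>

text \<open>
  The induced module is realised as the functions \<open>f\<close> on \<open>G\<close> with \<open>f (n x) = \<sigma> n (f x)\<close> for \<open>n \<in> N\<close>, on which
  \<open>G\<close> acts by right translation; evaluation at \<open>1\<close> is the required map. A function on \<open>G\<close>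
  is stored as a matrix whose columns are its values.
\<close>

lemma exists_irreducible_over:
  fixes \<sigma> :: "'a \<Rightarrow> 'k::alg_closed_field mat"
  assumes G: "group G" and fin: "finite (carrier G)" and N: "subgroup N G"
    and \<sigma>: "representation (G\<lparr>carrier := N\<rparr>) d \<sigma>"
  obtains m \<rho> E where "irreducible_representation G m \<rho>" "linear_vec m d E"
    "\<And>n v. n \<in> N \<Longrightarrow> v \<in> carrier_vec m \<Longrightarrow> E (\<rho> n *\<^sub>v v) = \<sigma> n *\<^sub>v E v"
    "\<exists>v\<in>carrier_vec m. E v \<noteq> 0\<^sub>v d"
proof -
  interpret group G by fact
  note N_group = subgroup_imp_group[OF N]
  have NG: "n \<in> carrier G" if "n \<in> N" for n using that subgroup.subset[OF N] by blast
  define K where "K = card (carrier G)"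
  have d: "0 < d" using \<sigma> by (simp add: representation_def)
  have K: "0 < K" using fin one_closed unfolding K_def by (metis card_gt_0_iff empty_iff)
  obtain en where en: "bij_betw en {..<K} (carrier G)"
    using ex_bij_betw_nat_finite[OF fin] unfolding K_def lessThan_atLeast0 by blast
  define ix where "ix = inv_into {..<K} en"
  have enG: "en a \<in> carrier G" if "a < K" for a
    using en that by (auto simp: bij_betw_def)
  have ix: "ix x < K" "en (ix x) = x" if "x \<in> carrier G" for x
    using bij_betwE[OF bij_betw_inv_into[OF en]] bij_betw_inv_into_right[OF en] that
    by (auto simp: ix_def)
  have ix_en: "ix (en a) = a" if "a < K" for a
    using en that by (auto simp: ix_def bij_betw_def)
  \<comment> \<open>Column \<open>a\<close> holds the value at \<open>en a\<close>. The new value at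
    \<open>x\<close> is the old value at \<open>x g\<close>, which makes this a left action.\<close>
  define T where "T g A = mat d K (\<lambda>(i, a). A $$ (i, ix (en a \<otimes>\<^bsub>G\<^esub> g)))" for g and A :: "'k mat"
  obtain P where P: "representation G (d * K) P"
    "\<And>g v. g \<in> carrier G \<Longrightarrow> v \<in> carrier_vec (d * K) \<Longrightarrow>
      mat_of_vec d K (P g *\<^sub>v v) = T g (mat_of_vec d K v)"
  proof (rule representation_on_matrices[OF G d K, of T])
    fix A :: "'k mat" assume A: "A \<in> carrier_mat d K"
    show "T \<one>\<^bsub>G\<^esub> A = A"
      using A by (intro eq_matI) (auto simp: T_def enG ix_en)
    fix g assume g: "g \<in> carrier G"
    show "T g A \<in> carrier_mat d K" by (simp add: T_def)
    show "T g (c \<cdot>\<^sub>m A) = c \<cdot>\<^sub>m T g A" for c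
      using A g by (intro eq_matI) (auto simp: T_def enG ix)
    show "T g (A + B) = T g A + T g B" if "B \<in> carrier_mat d K" for B
      using A g that by (intro eq_matI) (auto simp: T_def enG ix)
    fix h assume h: "h \<in> carrier G"
    show "T (g \<otimes>\<^bsub>G\<^esub> h) A = T g (T h A)"
      using A g h by (intro eq_matI) (auto simp: T_def enG ix m_assoc)
  qed blast
  define val where "val x v = col (mat_of_vec d K v) (ix x)" for x and v :: "'k vec"
  have val: "linear_vec (d * K) d (val x)" if "x \<in> carrier G" for x
    unfolding val_def by (rule linear_vec_mat_of_vec_col[OF ix(1)[OF that]])
  have val_P: "val x (P g *\<^sub>v v) = val (x \<otimes>\<^bsub>G\<^esub> g) v"
    if "x \<in> carrier G" "g \<in> carrier G" "v \<in> carrier_vec (d * K)" for x g v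
    using that by (intro eq_vecI) (auto simp: val_def P(2) T_def ix)
  have val_eqI: "v = 0\<^sub>v (d * K)" if v: "v \<in> carrier_vec (d * K)" and z: "\<And>x. x \<in> carrier G \<Longrightarrow> val x v = 0\<^sub>v d" for v
  proof (rule eq_vecI)
    fix k assume "k < dim_vec (0\<^sub>v (d * K) :: 'k vec)"
    then have k: "k < d * K" by simp
    have "val (en (k mod K)) v $ (k div K) = v $ k"
      using mat_index_div_mod[OF k] by (simp add: val_def ix_en mat_of_vec_def)
    then show "v $ k = 0\<^sub>v (d * K) $ k"
      using z[OF enG] mat_index_div_mod[OF k] k by simp
  qed (use v in simp)
  define U where "U = {v \<in> carrier_vec (d * K). \<forall>n\<in>N. \<forall>x\<in>carrier G. val (n \<otimes>\<^bsub>G\<^esub> x) v = \<sigma> n *\<^sub>v val x v}"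
  have \<sigma>_lin: "linear_vec d d (\<lambda>v. \<sigma> n *\<^sub>v v)" if "n \<in> N" for n
    by (rule representation_linear[OF N_group \<sigma>]) (use that in simp)
  have U_sub: "subspace class_ring U (module_vec TYPE('k) (d * K))"
  proof -
    have "val (n \<otimes>\<^bsub>G\<^esub> x) (v + w) = \<sigma> n *\<^sub>v val x (v + w)" "val (n \<otimes>\<^bsub>G\<^esub> x) (c \<cdot>\<^sub>v v) = \<sigma> n *\<^sub>v val x (c \<cdot>\<^sub>v v)"
      if "v \<in> U" "w \<in> U" "n \<in> N" "x \<in> carrier G" for v w c n x
    proof -
      have vw: "v \<in> carrier_vec (d * K)" "w \<in> carrier_vec (d * K)" using that by (auto simp: U_def)
      have nx: "n \<otimes>\<^bsub>G\<^esub> x \<in> carrier G" using NG that by simp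
      have eq: "val (n \<otimes>\<^bsub>G\<^esub> x) v = \<sigma> n *\<^sub>v val x v" "val (n \<otimes>\<^bsub>G\<^esub> x) w = \<sigma> n *\<^sub>v val x w"
        using that by (auto simp: U_def)
      note c = linear_vec_closed[OF val[OF that(4)] vw(1)] linear_vec_closed[OF val[OF that(4)] vw(2)]
      show "val (n \<otimes>\<^bsub>G\<^esub> x) (v + w) = \<sigma> n *\<^sub>v val x (v + w)"
        by (simp only: linear_vec_add[OF val[OF nx] vw] linear_vec_add[OF val[OF that(4)] vw]
            linear_vec_add[OF \<sigma>_lin[OF that(3)] c] eq)
      show "val (n \<otimes>\<^bsub>G\<^esub> x) (c \<cdot>\<^sub>v v) = \<sigma> n *\<^sub>v val x (c \<cdot>\<^sub>v v)" for c
        by (simp only: linear_vec_smult[OF val[OF nx] vw(1)] linear_vec_smult[OF val[OF that(4)] vw(1)]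
            linear_vec_smult[OF \<sigma>_lin[OF that(3)] c(1)] eq)
    qed
    moreover have "0\<^sub>v (d * K) \<in> U"
      using linear_vec_zero[OF val] linear_vec_zero[OF \<sigma>_lin] NG by (simp add: U_def)
    ultimately show ?thesis
      unfolding subspace_vec_iff by (auto simp: U_def)
  qed
  have U_stable: "P g *\<^sub>v v \<in> U" if "g \<in> carrier G" "v \<in> U" for g v
    using that NG representation_vec(1)[OF G P(1)] by (auto simp: U_def val_P m_assoc)
  have "U \<noteq> {0\<^sub>v (d * K)}"
  proof
    assume U0: "U = {0\<^sub>v (d * K)}"
    \<comment> \<open>The witness is supported on \<open>N\<close>, where its value at
      \<open>x\<close> is \<open>\<sigma> x\<close> applied to the first unit vector. It satisfies
      the condition of \<open>U\<close>, and its value at 1 is that unit vector.\<close>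
    define s where "s x = \<sigma> x *\<^sub>v unit_vec d 0" for x
    define A where "A = mat d K (\<lambda>(i, a). if en a \<in> N then s (en a) $ i else 0)"
    have A: "A \<in> carrier_mat d K" by (simp add: A_def)
    have valA: "val x (vec_of_mat A) = (if x \<in> N then s x else 0\<^sub>v d)" if "x \<in> carrier G" for x
    proof -
      have "s x \<in> carrier_vec d" if "x \<in> N"
        unfolding s_def by (rule representation_vec(1)[OF N_group \<sigma>]) (use that in auto)
      then show ?thesis
        unfolding val_def mat_of_vec_of_mat[OF A]
        using ix[OF that] by (intro eq_vecI) (auto simp: A_def)
    qed
    have "vec_of_mat A \<in> U"
      unfolding U_def
    proof (intro CollectI conjI ballI vec_of_mat_carrier[OF A])
      fix n x assume n: "n \<in> N" and x: "x \<in> carrier G"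
      have "n \<otimes>\<^bsub>G\<^esub> x \<in> N \<longleftrightarrow> x \<in> N"
      proof
        assume "n \<otimes>\<^bsub>G\<^esub> x \<in> N"
        then have "inv\<^bsub>G\<^esub> n \<otimes>\<^bsub>G\<^esub> (n \<otimes>\<^bsub>G\<^esub> x) \<in> N"
          by (rule subgroup.m_closed[OF N subgroup.m_inv_closed[OF N n]])
        then show "x \<in> N" using NG[OF n] x m_assoc[of "inv\<^bsub>G\<^esub> n" n x] by simp
      qed (use n subgroup.m_closed[OF N] in blast)
      moreover have "s (n \<otimes>\<^bsub>G\<^esub> x) = \<sigma> n *\<^sub>v s x" if "x \<in> N"
        unfolding s_def using representation_vec(3)[OF N_group \<sigma>, of "unit_vec d 0" n x] n that by simp
      moreover have "\<sigma> n *\<^sub>v 0\<^sub>v d = 0\<^sub>v d"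
        by (rule linear_vec_zero[OF \<sigma>_lin[OF n]])
      ultimately show "val (n \<otimes>\<^bsub>G\<^esub> x) (vec_of_mat A) = \<sigma> n *\<^sub>v val x (vec_of_mat A)"
        using NG[OF n] x by (simp add: valA)
    qed
    then have "vec_of_mat A = 0\<^sub>v (d * K)" using U0 by simp
    then have "val \<one>\<^bsub>G\<^esub> (vec_of_mat A) = 0\<^sub>v d" using linear_vec_zero[OF val[OF one_closed]] by simp
    then have "unit_vec d 0 = (0\<^sub>v d :: 'k vec)"
      using valA[OF one_closed, unfolded s_def] subgroup.one_closed[OF N] representation_vec(2)[OF N_group \<sigma>, of "unit_vec d 0"] by simp
    then have "unit_vec d 0 $ 0 = (0\<^sub>v d :: 'k vec) $ 0" by simp
    then show False using d by simp
  qed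
  then obtain m \<rho> f where \<rho>: "irreducible_representation G m \<rho>" and f: "linear_vec m (d * K) f"
      "inj_on f (carrier_vec m)" "f ` carrier_vec m \<subseteq> U"
      "\<And>g v. g \<in> carrier G \<Longrightarrow> v \<in> carrier_vec m \<Longrightarrow> f (\<rho> g *\<^sub>v v) = P g *\<^sub>v f v"
    using irreducible_subrepresentation[OF G P(1) U_sub _ U_stable] by metis
  note \<rho>_rep = irreducible_representationD(1)[OF \<rho>]
  have fc: "f v \<in> carrier_vec (d * K)" "f v \<in> U" if "v \<in> carrier_vec m" for v
    using that f(3) linear_vec_closed[OF f(1)] by auto
  show thesis
  proof (rule that[OF \<rho> linear_vec_comp[OF f(1) val[OF one_closed]]])
    fix n and v :: "'k vec" assume n: "n \<in> N" and v: "v \<in> carrier_vec m"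
    show "val \<one>\<^bsub>G\<^esub> (f (\<rho> n *\<^sub>v v)) = \<sigma> n *\<^sub>v val \<one>\<^bsub>G\<^esub> (f v)"
    proof -
      have "val \<one>\<^bsub>G\<^esub> (f (\<rho> n *\<^sub>v v)) = val (n \<otimes>\<^bsub>G\<^esub> \<one>\<^bsub>G\<^esub>) (f v)"
        using NG[OF n] v fc by (simp add: f(4) val_P)
      then show ?thesis using fc(2)[OF v] n one_closed unfolding U_def by auto
    qed
  next
    show "\<exists>v\<in>carrier_vec m. val \<one>\<^bsub>G\<^esub> (f v) \<noteq> 0\<^sub>v d"
    proof (rule ccontr)
      assume "\<not> ?thesis"
      then have z: "val \<one>\<^bsub>G\<^esub> (f v) = 0\<^sub>v d" if "v \<in> carrier_vec m" for v using that by blast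
      \<comment> \<open>The value of \<open>f v\<close> at \<open>x\<close> is the value of
        \<open>f (\<rho> x *\<^sub>v v)\<close> at 1. If evaluation at 1 vanished on the submodule,
        all its functions would be zero, against injectivity of \<open>f\<close>.\<close>
      have f0: "f v = 0\<^sub>v (d * K)" if v: "v \<in> carrier_vec m" for v
      proof (rule val_eqI[OF fc(1)[OF v]])
        fix x assume x: "x \<in> carrier G"
        have "val x (f v) = val \<one>\<^bsub>G\<^esub> (f (\<rho> x *\<^sub>v v))"
          using x v fc by (simp add: f(4) val_P)
        then show "val x (f v) = 0\<^sub>v d"
          using z[OF representation_vec(1)[OF G \<rho>_rep v x]] by simp
      qed
      have m: "0 < m" using \<rho>_rep by (simp add: representation_def)
      have "unit_vec m 0 = (0\<^sub>v m :: 'k vec)"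
        using inj_onD[OF f(2), of "unit_vec m 0" "0\<^sub>v m"] f0[of "unit_vec m 0"] f0[of "0\<^sub>v m"] by simp
      then have "unit_vec m 0 $ 0 = (0\<^sub>v m :: 'k vec) $ 0" by simp
      then show False using m by simp
    qed
  qed
qed

subsection \<open>Brauer characters\<close>

lemma char_poly_one: "char_poly (1\<^sub>m n :: 'k::field mat) = [:-1, 1:] ^ n"
proof -
  have "char_poly (1\<^sub>m n :: 'k mat) = (\<Prod>a\<leftarrow>diag_mat (1\<^sub>m n :: 'k mat). [:- a, 1:])"
    by (rule char_poly_upper_triangular[of _ n]) (auto simp: upper_triangular_def)
  also have "diag_mat (1\<^sub>m n :: 'k mat) = replicate n 1"
    by (rule nth_equalityI) (auto simp: diag_mat_def)
  finally show ?thesis by simp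
qed

text \<open>\<open>\<theta> 1\<close> is idempotent by multiplicativity, and nonzero because it is a
  root of unity.\<close>

lemma brauer_lift_one:
  assumes "prime p" "brauer_lift p \<theta>"
  shows "\<theta> 1 = 1"
proof -
  have one: "1 \<in> p_roots_of_unity p"
    using assms(1) prime_gt_1_nat[of p] by (auto simp: p_roots_of_unity_def intro!: exI[of _ 1])
  then have "\<theta> 1 * \<theta> 1 = \<theta> 1"
    using assms(2) by (metis brauer_lift_def mult_1)
  moreover have "\<theta> 1 \<in> p_roots_of_unity p"
    using assms(2) one by (auto simp: brauer_lift_def bij_betw_def)
  then have "\<theta> 1 \<noteq> 0" by (auto simp: p_roots_of_unity_def power_0_left)
  ultimately show ?thesis by simp
qed

text \<open>The identity matrix has the eigenvalue 1 with multiplicity \<open>n\<close>. Through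
  this value the hypothesis on character degrees becomes one on dimensions.\<close>

lemma brauer_character_one:
  fixes \<rho> :: "'a \<Rightarrow> 'k::alg_closed_field mat"
  assumes "prime p" "brauer_lift p \<theta>" "group G" "representation G n \<rho>"
  shows "brauer_character p \<theta> G \<rho> \<one>\<^bsub>G\<^esub> = of_nat n"
proof -
  have "\<one>\<^bsub>G\<^esub> \<in> p_regular p G"
    using assms(1,3) prime_gt_1_nat[of p] by (simp add: p_regular_def group.ord_id group.is_monoid monoid.one_closed)
  moreover have "\<rho> \<one>\<^bsub>G\<^esub> = 1\<^sub>m n"
    using assms(3,4) by (simp add: representation_iff)
  moreover have "(\<Sum>e\<in>#repeat_mset n {#1#}. \<theta> e) = of_nat n"
    by (induction n) (simp_all add: brauer_lift_one[OF assms(1,2)])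
  ultimately show ?thesis
    by (simp add: brauer_character_def char_poly_one proots_power)
qed

text \<open>Needed because Brauer characters are meaningful only on \<open>p_regular\<close>
  elements: conjugates must stay in that set.\<close>

lemma (in group) ord_conj:
  assumes "x \<in> carrier G" "y \<in> carrier G"
  shows "ord (y \<otimes> x \<otimes> inv y) = ord x"
proof -
  have cancel: "inv y \<otimes> (y \<otimes> z) = z" if "z \<in> carrier G" for z
    using assms that m_assoc[of "inv y" y z] by simp
  have "(y \<otimes> x \<otimes> inv y) [^] n = y \<otimes> x [^] n \<otimes> inv y" for n :: nat
  proof (induction n)
    case (Suc n)
    have "(y \<otimes> x \<otimes> inv y) [^] Suc n = (y \<otimes> x [^] n \<otimes> inv y) \<otimes> (y \<otimes> x \<otimes> inv y)"
      using Suc by simp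
    also have "\<dots> = y \<otimes> x [^] Suc n \<otimes> inv y"
      using assms by (simp add: m_assoc cancel)
    finally show ?case .
  qed (use assms in simp)
  moreover have "y \<otimes> z \<otimes> inv y = \<one> \<longleftrightarrow> z = \<one>" if "z \<in> carrier G" for z
    using assms that by (metis inv_closed inv_solve_right l_cancel_one' l_one m_closed one_closed r_one)
  ultimately have "ord (y \<otimes> x \<otimes> inv y) dvd n \<longleftrightarrow> ord x dvd n" for n
    using assms by (simp add: pow_eq_id[symmetric])
  then show ?thesis by (meson dvd_antisym dvd_refl)
qed

text \<open>A linear Brauer character is induced from the whole group. Since 1 by 1 matrices
  commute, it is constant on conjugates, so the induction sum consists of
  \<open>card (carrier H)\<close> equal terms and the division cancels that number.\<close>

lemma M_p_group_if_linear:
  fixes H :: "('a, 'b) monoid_scheme" and \<theta> :: "'k::alg_closed_field \<Rightarrow> complex"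
  assumes p: "prime p" "brauer_lift p \<theta>" and H: "group H" "finite (carrier H)"
    and linear: "\<And>n \<rho>. irreducible_representation H n (\<rho> :: 'a \<Rightarrow> 'k mat) \<Longrightarrow> n = 1"
  shows "M_p_group p \<theta> H"
  unfolding M_p_group_def
proof
  interpret group H by fact
  fix \<phi> assume "\<phi> \<in> IBr p \<theta> H"
  then obtain n and \<rho> :: "'a \<Rightarrow> 'k mat" where "irreducible_representation H n \<rho>"
    and \<phi>: "\<phi> = brauer_character p \<theta> H \<rho>"
    by (auto simp: IBr_def)
  with linear have \<rho>: "representation H 1 \<rho>"
    using irreducible_representationD(1) by metis
  have \<phi>_lin: "\<phi> \<in> linear_brauer_characters p \<theta> (H\<lparr>carrier := carrier H\<rparr>)"
    using \<rho> brauer_character_one[OF p H(1) \<rho>]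
    by (auto simp: linear_brauer_characters_def brauer_characters_def \<phi>)
  have c: "\<rho> g \<in> carrier_mat 1 1" if "g \<in> carrier H" for g
    using \<rho> that by (simp add: representation_iff[OF H(1)])
  have comm: "A * B = B * A" if "A \<in> carrier_mat 1 1" "B \<in> carrier_mat 1 1" for A B :: "'k mat"
    using that by (intro eq_matI) (auto simp: scalar_prod_def)
  have conj: "\<phi> (y \<otimes>\<^bsub>H\<^esub> x \<otimes>\<^bsub>H\<^esub> inv\<^bsub>H\<^esub> y) = \<phi> x" if x: "x \<in> p_regular p H" and y: "y \<in> carrier H" for x y
  proof -
    have xH: "x \<in> carrier H" using x by (simp add: p_regular_def)
    have "\<rho> (y \<otimes>\<^bsub>H\<^esub> x \<otimes>\<^bsub>H\<^esub> inv\<^bsub>H\<^esub> y) = \<rho> y * \<rho> x * \<rho> (inv\<^bsub>H\<^esub> y)"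
      using \<rho> xH y by (simp add: representation_iff[OF H(1)])
    also have "\<dots> = \<rho> x * \<rho> y * \<rho> (inv\<^bsub>H\<^esub> y)"
      using comm[OF c[OF y] c[OF xH]] by simp
    also have "\<dots> = \<rho> ((x \<otimes>\<^bsub>H\<^esub> y) \<otimes>\<^bsub>H\<^esub> inv\<^bsub>H\<^esub> y)"
      using \<rho> xH y by (simp add: representation_iff[OF H(1)])
    also have "\<dots> = \<rho> x"
      using xH y by (simp add: m_assoc)
    finally show ?thesis
      using x y xH by (simp add: \<phi> brauer_character_def p_regular_def ord_conj)
  qed
  have "\<phi> = induced p H (carrier H) \<phi>"
  proof
    fix x
    have card: "card (carrier H) \<noteq> 0" using H(2) one_closed by auto
    show "\<phi> x = induced p H (carrier H) \<phi> x"
    proof (cases "x \<in> p_regular p H")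
      case True
      then have xH: "x \<in> carrier H" by (simp add: p_regular_def)
      have "{y. y \<in> carrier H \<and> y \<otimes>\<^bsub>H\<^esub> x \<otimes>\<^bsub>H\<^esub> inv\<^bsub>H\<^esub> y \<in> carrier H} = carrier H"
        using xH by auto
      then have "induced p H (carrier H) \<phi> x = (\<Sum>y\<in>carrier H. \<phi> x) / of_nat (card (carrier H))"
        using True by (simp add: induced_def conj)
      with card show ?thesis by simp
    qed (simp add: \<phi> brauer_character_def induced_def)
  qed
  with \<phi>_lin show "monomial p \<theta> H \<phi>"
    unfolding monomial_def using subgroup_self by blast
qed

text \<open>Every element of the quotient is a coset \<open>N g\<close>, so the inflated and the
  original representation have the same stable subspaces.\<close>

lemma inflate_irreducible:
  fixes \<phi> :: "'a set \<Rightarrow> 'k::alg_closed_field mat"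
  assumes G: "group G" and N: "N \<lhd> G" and \<phi>: "irreducible_representation (G Mod N) q \<phi>"
  shows "irreducible_representation G q (\<lambda>g. \<phi> (N #>\<^bsub>G\<^esub> g))"
    and "n \<in> N \<Longrightarrow> \<phi> (N #>\<^bsub>G\<^esub> n) = 1\<^sub>m q"
proof -
  interpret normal N G by fact
  note Q = factorgroup_is_group
  note \<phi>_rep = irreducible_representationD(1)[OF \<phi>]
  have hom: "(\<lambda>g. N #>\<^bsub>G\<^esub> g) \<in> hom G (G Mod N)" by (rule r_coset_hom_Mod)
  have "representation G q (\<lambda>g. \<phi> (N #>\<^bsub>G\<^esub> g))"
    using hom \<phi>_rep by (auto simp: representation_def hom_def Pi_iff)
  moreover have "\<exists>g\<in>carrier G. C = N #>\<^bsub>G\<^esub> g" if "C \<in> carrier (G Mod N)" for C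
    using that by (auto simp: FactGroup_def RCOSETS_def)
  then have "(\<forall>g\<in>carrier G. \<forall>w\<in>W. \<phi> (N #>\<^bsub>G\<^esub> g) *\<^sub>v w \<in> W) \<Longrightarrow> (\<forall>g\<in>carrier (G Mod N). \<forall>w\<in>W. \<phi> g *\<^sub>v w \<in> W)" for W
    by metis
  ultimately show "irreducible_representation G q (\<lambda>g. \<phi> (N #>\<^bsub>G\<^esub> g))"
    using \<phi> by (auto simp: irreducible_representation_def)
  show "\<phi> (N #>\<^bsub>G\<^esub> n) = 1\<^sub>m q" if "n \<in> N"
    using \<phi>_rep that rcos_const[OF G that] by (simp add: representation_iff[OF Q])
qed

theorem theorem2:
  fixes G :: "('a, 'b) monoid_scheme" and N :: "'a set" and p :: nat
    and \<theta> :: "'k::alg_closed_field \<Rightarrow> complex"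
  assumes "prime p"
    and "CHAR('k) = p"
    and "brauer_lift p \<theta>"
    and "group G"
    and "finite (carrier G)"
    and "N \<lhd> G"
    and "\<And>\<phi>. \<phi> \<in> IBr p \<theta> G \<Longrightarrow> \<phi> \<one>\<^bsub>G\<^esub> \<noteq> 1 \<Longrightarrow> \<exists>q::nat. prime q \<and> \<phi> \<one>\<^bsub>G\<^esub> = of_nat q"
  shows "M_p_group p \<theta> (G\<lparr>carrier := N\<rparr>) \<or> M_p_group p \<theta> (G Mod N)"
proof (rule ccontr)
  assume contra: "\<not> ?thesis"
  interpret normal N G by fact
  have N_group: "group (G\<lparr>carrier := N\<rparr>)" by (rule subgroup_imp_group[OF subgroup_axioms])
  have N_fin: "finite (carrier (G\<lparr>carrier := N\<rparr>))"
    using finite_subset[OF subset assms(5)] by simp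
  have Q_fin: "finite (carrier (G Mod N))"
    using assms(5) by (simp add: FactGroup_def RCOSETS_def)
  \<comment> \<open>By the contrapositive of \<open>M_p_group_if_linear\<close>, a group that fails
    to be an \<open>M_p_group\<close> has an irreducible representation of degree other than 1; the
    same is used for the quotient.\<close>
  obtain d and \<sigma> :: "'a \<Rightarrow> 'k mat" where over: "irreducible_representation (G\<lparr>carrier := N\<rparr>) d \<sigma>" "d \<noteq> 1"
    using contra M_p_group_if_linear[OF assms(1,3) N_group N_fin] by blast
  obtain q and \<phi> :: "'a set \<Rightarrow> 'k mat" where \<phi>: "irreducible_representation (G Mod N) q \<phi>" "q \<noteq> 1"
    using contra M_p_group_if_linear[OF assms(1,3) factorgroup_is_group Q_fin] by blast
  have prime_degree: "prime n" if n: "irreducible_representation G n \<rho>" "n \<noteq> 1" for n and \<rho> :: "'a \<Rightarrow> 'k mat"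
  proof -
    have one: "brauer_character p \<theta> G \<rho> \<one>\<^bsub>G\<^esub> = of_nat n"
      by (rule brauer_character_one[OF assms(1,3,4) irreducible_representationD(1)[OF n(1)]])
    have "brauer_character p \<theta> G \<rho> \<in> IBr p \<theta> G" using n by (auto simp: IBr_def)
    from assms(7)[OF this] show ?thesis using n(2) by (auto simp: one)
  qed
  obtain m \<rho> E where irr: "irreducible_representation G m \<rho>" and int: "linear_vec m d E"
    "\<And>n v. n \<in> N \<Longrightarrow> v \<in> carrier_vec m \<Longrightarrow> E (\<rho> n *\<^sub>v v) = \<sigma> n *\<^sub>v E v"
    "\<exists>v\<in>carrier_vec m. E v \<noteq> 0\<^sub>v d"
    using exists_irreducible_over[OF assms(4,5) subgroup_axioms irreducible_representationD(1)[OF over(1)]] by blast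
  interpret intertwined_representations G N \<rho> \<sigma> m d E
    by unfold_locales (use assms(5,6) irr over int in auto)
  have "0 < m" using \<rho>_rep by (simp add: representation_def)
  \<comment> \<open>\<open>d\<close> divides \<open>m\<close> and is not 1, so \<open>m\<close> is
    not 1 either and is prime by hypothesis. A divisor of \<open>m\<close> other than 1 then has to
    be \<open>m\<close> itself.\<close>
  then have m: "m \<noteq> 1" "prime m"
    using degree_dvd over(2) prime_degree[OF irr] by auto
  then have "d = m"
    using degree_dvd over(2) by (auto simp: prime_nat_iff)
  note inflated = inflate_irreducible[OF assms(4,6) \<phi>(1)]
  obtain \<psi> :: "'a \<Rightarrow> 'k mat" where "irreducible_representation G (m * q) \<psi>"
    using tensor_irreducible[OF assms(4) subgroup_axioms \<rho>_rep restrict_irreducible[OF \<open>d = m\<close>] inflated] by blast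
  \<comment> \<open>The degree \<open>m * q\<close> is not 1 because \<open>m\<close> is not, so the
    hypothesis makes it prime although neither factor is 1.\<close>
  then have "prime (m * q)"
    using prime_degree m(1) by auto
  then show False
    using m(1) \<phi>(2) prime_product by blast
qed

end
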